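(* Let $\Gamma^-$ be a lower differential game satisfying the standing assumptions in the context. A nonempty closed set $D\subset\mathbb{R}^n$ is a dominion of player 1 in the lower game $\Gamma^-$ if and only if $$\forall x\in D,\ \forall p\in NP_D(x),\quad H_\infty(x,p)\ge0,\qquad\text{i.e.}\quad \max_{b\in B}\min_{a\in A}\langle f(x,a,b),p\rangle\le0 .$$
   Context: Setting (standing assumptions). $A,B$ are nonempty compact metric spaces, $|\cdot|$ is the Euclidean norm and $\langle\cdot,\cdot\rangle$ the standard scalar product. $f:\mathbb{R}^n\times A\times B\to\mathbb{R}^n$ is continuous, $\mathbb{Z}^n$-periodic in $x$ (hence bounded), and there is $L_f\ge0$ with $|f(x,a,b)-f(y,a,b)|\le L_f|x-y|$ for all $x,y,a,b$. (The game also has a running payoff $\ell:\mathbb{R}^n\times A\times B\to\mathbb{R}$, bounded, continuous, $\mathbb{Z}^n$-periodic in $x$ and uniformly continuous in $x$ uniformly in $(a,b)$; it plays no role in the notion of dominion or in $H_\infty$.) $\mathscr{A}$ (resp. $\mathscr{B}$) is the set of Lebesgue measurable functions $[0,+\infty)\to A$ (resp. $B$), called controls of player 1 (resp. 2). For $x\in\mathbb{R}^n$, $a\in\mathscr{A}$, $b\in\mathscr{B}$, $X^{x,a,b}_t$ is the unique solution of $\dot X_t=f(X_t,a_t,b_t)$ for a.e. $t>0$, $X_0=x$. A nonanticipating strategy of player 1 is a map $\alpha:\mathscr{B}\to\mathscr{A}$ such that for all $t>0$ and $b^1,b^2\in\mathscr{B}$, if $b^1_s=b^2_s$ for a.e.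 $s\le t$ then $\alpha[b^1]_s=\alpha[b^2]_s$ for a.e. $s\le t$; $\mathfrak{A}$ is the set of these. Write $X^{x,\alpha,b}_t=X^{x,\alpha[b],b}_t$. For $K\subset\mathbb{R}^n$, $\operatorname{dist}_K(x)=\inf_{y\in K}|y-x|$. A dominion of player 1 in $\Gamma^-$ is a nonempty closed set $D\subset\mathbb{R}^n$ such that for all $x\in D$, $\varepsilon>0$, $T\ge0$ there is $\alpha\in\mathfrak{A}$ such that for all $b\in\mathscr{B}$ and $t\in[0,T]$, $\operatorname{dist}_D(X^{x,\alpha,b}_t)\le\varepsilon$. $H_\infty(x,p)=\min_{b\in B}\max_{a\in A}\{-\langle f(x,a,b),p\rangle\}$ for $x,p\in\mathbb{R}^n$. A vector $p\in\mathbb{R}^n$ is a proximal normal to $K\subset\mathbb{R}^n$ at $x\in K$ if $\operatorname{dist}_K(x+p)=|p|$; $NP_K(x)$ is the set of proximal normals to $K$ at $x$. *)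

theory Defs
  imports "HOL-Analysis.Analysis"
begin

text \<open>
  The action sets are subsets \<open>A\<close>, \<open>B\<close> of arbitrary metric spaces, and the dynamics \<open>f x a b\<close> and
  the running payoff \<open>l x a b\<close> are constrained only for \<open>a \<in> A\<close> and \<open>b \<in> B\<close>.
\<close>

locale differential_game =
  fixes A :: "'a::metric_space set"
    and B :: "'b::metric_space set"
    and f :: "real ^ 'n \<Rightarrow> 'a \<Rightarrow> 'b \<Rightarrow> real ^ 'n"
    and l :: "real ^ 'n \<Rightarrow> 'a \<Rightarrow> 'b \<Rightarrow> real"
  assumes A_compact: "compact A" and A_nonempty: "A \<noteq> {}"
    and B_compact: "compact B" and B_nonempty: "B \<noteq> {}"
    and f_continuous: "continuous_on (UNIV \<times> A \<times> B) (\<lambda>(x, a, b). f x a b)"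
    and f_periodic: "\<lbrakk>\<And>i. z $ i \<in> \<int>; a \<in> A; b \<in> B\<rbrakk> \<Longrightarrow> f (x + z) a b = f x a b"
    and f_Lipschitz:
      "\<exists>L\<ge>0. \<forall>x y. \<forall>a\<in>A. \<forall>b\<in>B. norm (f x a b - f y a b) \<le> L * norm (x - y)"
    and l_bounded: "\<exists>M. \<forall>x. \<forall>a\<in>A. \<forall>b\<in>B. \<bar>l x a b\<bar> \<le> M"
    and l_continuous: "continuous_on (UNIV \<times> A \<times> B) (\<lambda>(x, a, b). l x a b)"
    and l_periodic: "\<lbrakk>\<And>i. z $ i \<in> \<int>; a \<in> A; b \<in> B\<rbrakk> \<Longrightarrow> l (x + z) a b = l x a b"
    and l_uniformly_continuous:
      "\<forall>e>0. \<exists>d>0. \<forall>x y. norm (x - y) < d \<longrightarrow> (\<forall>a\<in>A. \<forall>b\<in>B. \<bar>l x a b - l y a b\<bar> < e)"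

text \<open>
  Functions on \<open>[0,\<infinity>)\<close> are extensional (equal to \<open>undefined\<close> on negative arguments), so that
  \<open>controls A\<close> is in bijection with the measurable functions \<open>[0,\<infinity>) \<rightarrow> A\<close>; two controls that
  agree only almost everywhere are still distinct.
\<close>

definition controls :: "'a::metric_space set \<Rightarrow> (real \<Rightarrow> 'a) set" where
  "controls A = ({0..} \<rightarrow>\<^sub>E A) \<inter> borel_measurable (lebesgue_on {0..})"

definition strategies ::
    "'a::metric_space set \<Rightarrow> 'b::metric_space set \<Rightarrow> ((real \<Rightarrow> 'b) \<Rightarrow> (real \<Rightarrow> 'a)) set" where
  "strategies A B = {\<alpha> \<in> controls B \<rightarrow> controls A.
     \<forall>t>0. \<forall>b1\<in>controls B. \<forall>b2\<in>controls B.
       (AE s in lebesgue_on {0..t}. b1 s = b2 s) \<longrightarrow>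
       (AE s in lebesgue_on {0..t}. \<alpha> b1 s = \<alpha> b2 s)}"

definition abs_continuous_on_interval ::
    "real \<Rightarrow> real \<Rightarrow> (real \<Rightarrow> 'c::real_normed_vector) \<Rightarrow> bool" where
  "abs_continuous_on_interval r s X \<longleftrightarrow>
     (\<forall>e>0. \<exists>d>0. \<forall>P. finite P \<longrightarrow> (\<forall>(u, v)\<in>P. r \<le> u \<and> u \<le> v \<and> v \<le> s) \<longrightarrow>
        disjoint_family_on (\<lambda>(u, v). {u<..<v}) P \<longrightarrow>
        (\<Sum>(u, v)\<in>P. v - u) < d \<longrightarrow> (\<Sum>(u, v)\<in>P. norm (X v - X u)) < e)"

text \<open>
  Solutions are taken in the sense of Caratheodory: without local absolute continuity the
  differential equation, required only almost everywhere, would not have unique solutions.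
\<close>

definition solution ::
    "(real ^ 'n \<Rightarrow> 'a \<Rightarrow> 'b \<Rightarrow> real ^ 'n) \<Rightarrow> real ^ 'n \<Rightarrow> (real \<Rightarrow> 'a) \<Rightarrow> (real \<Rightarrow> 'b) \<Rightarrow>
     (real \<Rightarrow> real ^ 'n) \<Rightarrow> bool" where
  "solution f x a b X \<longleftrightarrow>
     X 0 = x \<and>
     (\<forall>T\<ge>0. abs_continuous_on_interval 0 T X) \<and>
     (AE t in lebesgue. 0 < t \<longrightarrow> (X has_vector_derivative f (X t) (a t) (b t)) (at t))"

text \<open>
  Solutions are determined only on \<open>[0,\<infinity>)\<close>, so the value at time \<open>t\<close> is selected rather than the
  function; this is meaningful for \<open>t \<ge> 0\<close>.
\<close>

definition trajectory ::
    "(real ^ 'n \<Rightarrow> 'a \<Rightarrow> 'b \<Rightarrow> real ^ 'n) \<Rightarrow> real ^ 'n \<Rightarrow> (real \<Rightarrow> 'a) \<Rightarrow> (real \<Rightarrow> 'b) \<Rightarrow>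
     real \<Rightarrow> real ^ 'n" where
  "trajectory f x a b t = (THE y. \<exists>X. solution f x a b X \<and> X t = y)"

definition dominion ::
    "'a::metric_space set \<Rightarrow> 'b::metric_space set \<Rightarrow> (real ^ 'n \<Rightarrow> 'a \<Rightarrow> 'b \<Rightarrow> real ^ 'n) \<Rightarrow>
     (real ^ 'n) set \<Rightarrow> bool" where
  "dominion A B f D \<longleftrightarrow> D \<noteq> {} \<and> closed D \<and>
     (\<forall>x\<in>D. \<forall>\<epsilon>>0. \<forall>T\<ge>0. \<exists>\<alpha>\<in>strategies A B. \<forall>b\<in>controls B. \<forall>t\<in>{0..T}.
        infdist (trajectory f x (\<alpha> b) b t) D \<le> \<epsilon>)"

text \<open>
  The infimum and the suprema are attained for continuous \<open>f\<close> on compact action sets, see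
  \<open>H_inf_attained\<close> and \<open>max_min_attained\<close> below, so they are the minimum and the maxima.
\<close>

definition H_inf ::
    "'a set \<Rightarrow> 'b set \<Rightarrow> (real ^ 'n \<Rightarrow> 'a \<Rightarrow> 'b \<Rightarrow> real ^ 'n) \<Rightarrow> real ^ 'n \<Rightarrow> real ^ 'n \<Rightarrow> real" where
  "H_inf A B f x p = (INF b\<in>B. SUP a\<in>A. - (f x a b \<bullet> p))"

definition proximal_normals :: "(real ^ 'n) set \<Rightarrow> real ^ 'n \<Rightarrow> (real ^ 'n) set" where
  "proximal_normals K x = {p. infdist (x + p) K = norm p}"

lemma min_max_attained:
  fixes h :: "'a::metric_space \<Rightarrow> 'b::metric_space \<Rightarrow> real"
  assumes "compact A" "A \<noteq> {}" "compact B" "B \<noteq> {}"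
    and h: "continuous_on (A \<times> B) (\<lambda>(a, b). h a b)"
  shows "\<forall>b\<in>B. \<exists>a\<in>A. h a b = (SUP a\<in>A. h a b) \<and> (\<forall>a'\<in>A. h a' b \<le> h a b)"
    and "\<exists>b\<in>B. (SUP a\<in>A. h a b) = (INF b\<in>B. SUP a\<in>A. h a b) \<and>
           (\<forall>b'\<in>B. (SUP a\<in>A. h a b) \<le> (SUP a\<in>A. h a b'))"
proof -
  show 1: "\<forall>b\<in>B. \<exists>a\<in>A. h a b = (SUP a\<in>A. h a b) \<and> (\<forall>a'\<in>A. h a' b \<le> h a b)"
  proof
    fix b assume b: "b \<in> B"
    have "continuous_on A (\<lambda>a. h a b)"
      using continuous_on_compose2[OF h continuous_on_Pair[OF continuous_on_id
          continuous_on_const[of A b]]] b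
      by (simp add: image_subset_iff)
    then obtain a where a: "a \<in> A" "\<forall>a'\<in>A. h a' b \<le> h a b"
      using continuous_attains_sup[OF assms(1,2)] by blast
    then have "h a b = (SUP a\<in>A. h a b)"
      by (intro cSup_eq_maximum[symmetric]) auto
    with a show "\<exists>a\<in>A. h a b = (SUP a\<in>A. h a b) \<and> (\<forall>a'\<in>A. h a' b \<le> h a b)" by blast
  qed
  let ?g = "\<lambda>b. SUP a\<in>A. h a b"
  have uc: "uniformly_continuous_on (A \<times> B) (\<lambda>(a, b). h a b)"
    using compact_uniformly_continuous[OF h] assms by (simp add: compact_Times)
  have "continuous_on B ?g"
    unfolding continuous_on_iff
  proof (intro ballI allI impI)
    fix b and e :: real assume b: "b \<in> B" and e: "0 < e"
    obtain d where d: "d > 0"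
      "\<And>z z'. \<lbrakk>z \<in> A \<times> B; z' \<in> A \<times> B; dist z' z < d\<rbrakk> \<Longrightarrow>
         dist ((\<lambda>(a, b). h a b) z') ((\<lambda>(a, b). h a b) z) < e"
      using uc e unfolding uniformly_continuous_on_def by metis
    have "dist (?g b') (?g b) < e" if b': "b' \<in> B" "dist b' b < d" for b'
    proof -
      have close: "dist (h a b') (h a b) < e" if "a \<in> A" for a
        using d(2)[of "(a, b)" "(a, b')"] that b b' by (simp add: dist_Pair_Pair)
      obtain a where a: "a \<in> A" "h a b = ?g b" "\<forall>a'\<in>A. h a' b \<le> h a b" using 1 b by blast
      obtain a' where a': "a' \<in> A" "h a' b' = ?g b'" "\<forall>a\<in>A. h a b' \<le> h a' b'"
        using 1 b' by blast
      show ?thesis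
        using a(3)[rule_format, OF a'(1)] a'(3)[rule_format, OF a(1)] close[OF a(1)]
          close[OF a'(1)]
        unfolding a(2)[symmetric] a'(2)[symmetric] dist_real_def by linarith
    qed
    then show "\<exists>d>0. \<forall>b'\<in>B. dist b' b < d \<longrightarrow> dist (?g b') (?g b) < e" using d(1) by blast
  qed
  from continuous_attains_inf[OF assms(3,4) this]
  obtain b where b: "b \<in> B" "\<forall>b'\<in>B. ?g b \<le> ?g b'" by blast
  then have "?g b = (INF b\<in>B. ?g b)"
    by (intro cInf_eq_minimum[symmetric]) auto
  with b show "\<exists>b\<in>B. ?g b = (INF b\<in>B. ?g b) \<and> (\<forall>b'\<in>B. ?g b \<le> ?g b')" by blast
qed

context differential_game
begin

lemma continuous_on_inner_f: "continuous_on (A \<times> B) (\<lambda>(a, b). - (f x a b \<bullet> p))"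
proof -
  have "continuous_on (A \<times> B) (\<lambda>z. f x (fst z) (snd z))"
    using continuous_on_compose2[OF f_continuous
        continuous_on_Pair[OF continuous_on_const continuous_on_id], of x "A \<times> B"]
    by (auto simp: case_prod_beta)
  then show ?thesis
    by (auto intro!: continuous_intros simp: case_prod_beta)
qed

lemma H_inf_attained:
  shows "\<forall>b\<in>B. \<exists>a\<in>A. - (f x a b \<bullet> p) = (SUP a\<in>A. - (f x a b \<bullet> p)) \<and>
           (\<forall>a'\<in>A. - (f x a' b \<bullet> p) \<le> - (f x a b \<bullet> p))"
    and "\<exists>b\<in>B. (SUP a\<in>A. - (f x a b \<bullet> p)) = H_inf A B f x p \<and>
           (\<forall>b'\<in>B. (SUP a\<in>A. - (f x a b \<bullet> p)) \<le> (SUP a\<in>A. - (f x a b' \<bullet> p)))"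
  unfolding H_inf_def
  by (rule min_max_attained[OF A_compact A_nonempty B_compact B_nonempty
        continuous_on_inner_f[of x p]])+

lemma max_min_attained:
  shows "\<forall>b\<in>B. \<exists>a\<in>A. f x a b \<bullet> p = (INF a\<in>A. f x a b \<bullet> p) \<and>
           (\<forall>a'\<in>A. f x a b \<bullet> p \<le> f x a' b \<bullet> p)"
    and "\<exists>b\<in>B. (INF a\<in>A. f x a b \<bullet> p) = (SUP b\<in>B. INF a\<in>A. f x a b \<bullet> p) \<and>
           (\<forall>b'\<in>B. (INF a\<in>A. f x a b' \<bullet> p) \<le> (INF a\<in>A. f x a b \<bullet> p))"
proof -
  have neg: "(SUP a\<in>A. - (f x a b \<bullet> p)) = - (INF a\<in>A. f x a b \<bullet> p)" for b
    by (simp add: Inf_real_def image_image)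
  show "\<forall>b\<in>B. \<exists>a\<in>A. f x a b \<bullet> p = (INF a\<in>A. f x a b \<bullet> p) \<and>
           (\<forall>a'\<in>A. f x a b \<bullet> p \<le> f x a' b \<bullet> p)"
    using H_inf_attained(1)[of x p] unfolding neg neg_equal_iff_equal neg_le_iff_le .
  obtain b where b: "b \<in> B" "\<forall>b'\<in>B. (INF a\<in>A. f x a b' \<bullet> p) \<le> (INF a\<in>A. f x a b \<bullet> p)"
    using H_inf_attained(2)[of x p] unfolding neg neg_le_iff_le by blast
  moreover have "(INF a\<in>A. f x a b \<bullet> p) = (SUP b\<in>B. INF a\<in>A. f x a b \<bullet> p)"
    using b by (intro cSup_eq_maximum[symmetric]) auto
  ultimately show "\<exists>b\<in>B. (INF a\<in>A. f x a b \<bullet> p) = (SUP b\<in>B. INF a\<in>A. f x a b \<bullet> p) \<and>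
           (\<forall>b'\<in>B. (INF a\<in>A. f x a b' \<bullet> p) \<le> (INF a\<in>A. f x a b \<bullet> p))" by blast
qed

end

end

theory Submission
  imports Defs
begin

text \<open>
  Since the minimum and the maxima are attained, both forms of the condition say the same: at every
  \<open>x \<in> D\<close>, for every proximal normal \<open>p\<close> of \<open>D\<close> at \<open>x\<close>, each action \<open>b\<close> of player 2 has a reply \<open>a\<close>
  with \<open>f x a b \<bullet> p \<le> 0\<close>, that is, to first order player 1 can refuse to leave \<open>D\<close> along \<open>p\<close>.

  The condition is necessary (\<open>dominion_imp_proximal_condition\<close>). Suppose that some \<open>b\<close> has
  \<open>f x a b \<bullet> p \<ge> \<eta> > 0\<close> for all \<open>a\<close>, and let player 2 play \<open>b\<close> constantly. Whatever
  player 1 does, the inner product of \<open>p\<close> with the displacement after a short time \<open>t\<close> is then at least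
  about \<open>\<eta> t\<close>, while the displacement has norm \<open>O(t)\<close>, and so the state enters the open ball of radius
  \<open>norm p\<close> about \<open>x + p\<close>. That ball does not meet \<open>D\<close>, because \<open>p\<close> is a proximal normal.
  The depth reached at one fixed time depends only on \<open>\<eta>\<close>, \<open>norm p\<close> and the constants of \<open>f\<close>,
  so no strategy keeps the distance from \<open>D\<close> below it.

  The condition is sufficient by extremal aiming (\<open>infdist_step\<close>, \<open>grid_strategy\<close>). Player 1 looks
  at the state \<open>y\<close> at the times of a grid of step \<open>h\<close>, takes a nearest point \<open>q\<close> of \<open>D\<close>, for which
  \<open>y - q\<close> is a proximal normal, and until the next grid time answers each action \<open>b\<close> by an action
  \<open>a\<close> with \<open>f q a b \<bullet> (y - q) \<le> h\<close>. With \<open>d = norm (y - q)\<close>, the first-order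
  change of the squared distance from \<open>q\<close> is \<open>2 h (f y a b \<bullet> (y - q))\<close>, and replacing \<open>q\<close> by \<open>y\<close> in the
  first argument of \<open>f\<close> costs a multiple of \<open>d\<close>, so the squared distance from \<open>D\<close> satisfies
  \<open>d'\<^sup>2 \<le> (1 + K h) d\<^sup>2 + K h\<^sup>2\<close>. Starting from \<open>0\<close> it is at most \<open>h exp (K T)\<close> up to
  time \<open>T\<close>, which is as small as desired. The strategy is nonanticipating since the state at a grid
  time depends only on the past controls. The tolerance \<open>h\<close> in the choice of the reply makes a
  finite-valued Borel function of \<open>b\<close> available (\<open>compact_finite_valued_selection\<close>), so that the
  answer to a measurable control is measurable.

  All of this rests on the integral equation of a trajectory (\<open>trajectory_has_integral\<close>). A
  Caratheodory solution satisfies it by the fundamental theorem of calculus for absolutely continuous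
  functions, and conversely a solution of the integral equation is differentiable almost everywhere by
  Lebesgue's differentiation theorem. Existence and uniqueness for the integral equation come from
  Picard iteration, which contracts by the factor \<open>1/2\<close> in a supremum norm with exponential weight.
\<close>

section \<open>Indefinite integrals of functions of time\<close>

lemma has_integral_degenerate_interval:
  fixes f :: "real \<Rightarrow> 'a::real_normed_vector"
  assumes "(f has_integral i) {a..a}"
  shows "i = 0"
  using has_integral_unique[of f i "{a}" 0] has_integral_refl(2)[of f a] assms by simp

lemma has_integral_interval_diff:
  fixes f :: "real \<Rightarrow> 'a::banach"
  assumes "\<And>t. 0 \<le> t \<Longrightarrow> (f has_integral F t) {0..t}" "0 \<le> s" "s \<le> t"
  shows "(f has_integral (F t - F s)) {s..t}"
proof -
  have "f integrable_on {0..t}" "integral {0..t} f = F t" "integral {0..s} f = F s"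
    using assms(1)[of t] assms(1)[of s] assms(2,3) by (auto intro!: integral_unique has_integral_integrable)
  moreover from this have "integral {0..s} f + integral {s..t} f = integral {0..t} f"
    using Henstock_Kurzweil_Integration.integral_combine[of 0 s t f] assms by simp
  moreover have "f integrable_on {s..t}"
    using integrable_on_subinterval[OF \<open>f integrable_on {0..t}\<close>, of s t] assms by auto
  ultimately show ?thesis by (simp add: has_integral_iff algebra_simps)
qed

lemma has_integral_norm_le_const:
  fixes f :: "real \<Rightarrow> 'a::banach"
  assumes "(f has_integral i) {s..t}" "s \<le> t" "\<And>r. r \<in> {s..t} \<Longrightarrow> norm (f r) \<le> M"
  shows "norm i \<le> M * (t - s)"
proof -
  have "M \<ge> 0" using assms(3)[of s] \<open>s \<le> t\<close> order_trans[OF norm_ge_zero[of "f s"]] by simp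
  then show ?thesis using has_integral_bound_real[of M "{}" f i s t] assms by simp
qed

lemma indefinite_integral_lipschitz:
  fixes X :: "real \<Rightarrow> 'a::euclidean_space"
  assumes "\<And>t. 0 \<le> t \<Longrightarrow> (f has_integral (X t - x)) {0..t}"
    and bnd: "\<And>s. 0 \<le> s \<Longrightarrow> norm (f s) \<le> M"
  shows "M-lipschitz_on {0..} X"
proof (rule lipschitz_onI)
  have le: "norm (X t - X s) \<le> M * (t - s)" if "0 \<le> s" "s \<le> t" for s t
  proof -
    have "(f has_integral (X t - X s)) {s..t}"
      using has_integral_interval_diff[of f "\<lambda>t. X t - x", OF assms(1) that] by simp
    then show ?thesis using that bnd by (intro has_integral_norm_le_const) auto
  qed
  show "dist (X s) (X t) \<le> M * dist s t" if "s \<in> {0..}" "t \<in> {0..}" for s t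
    using that le[of s t] le[of t s]
    by (cases s t rule: linorder_cases) (auto simp: dist_norm norm_minus_commute)
  show "0 \<le> M" using bnd[of 0] norm_ge_zero[of "f 0"] by linarith
qed

lemma AE_lebesgue_on_negligible:
  "(AE s in lebesgue_on {0..t}. P s) \<longleftrightarrow> (\<exists>N. negligible N \<and> (\<forall>s\<in>{0..t::real} - N. P s))"
proof -
  have "(AE s in lebesgue_on {0..t}. P s) \<longleftrightarrow> (AE s in lebesgue. s \<in> {0..t} \<longrightarrow> P s)"
    by (rule AE_restrict_space_iff) simp
  also have "\<dots> \<longleftrightarrow> (\<exists>N. negligible N \<and> (\<forall>s\<in>{0..t} - N. P s))"
    unfolding eventually_ae_filter_negligible by (intro arg_cong[of _ _ Ex] ext) blast
  finally show ?thesis .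
qed

text \<open>
  Lebesgue's differentiation theorem on the line. The theorem on averages over the boxes
  \<open>cbox x (x + h *\<^sub>R One)\<close> yields right derivatives; applied to the reflected function it yields left
  derivatives as well.
\<close>
lemma indefinite_integral_has_vector_derivative_AE:
  fixes g :: "real \<Rightarrow> 'b::euclidean_space"
  assumes int: "\<And>a b. g integrable_on {a..b}"
  obtains N where "negligible N"
    "\<And>t a. t \<notin> N \<Longrightarrow> a < t \<Longrightarrow> ((\<lambda>u. integral {a..u} g) has_vector_derivative g t) (at t)"
proof -
  obtain N1 where N1: "negligible N1" "\<And>x e. x \<notin> N1 \<Longrightarrow> 0 < e \<Longrightarrow>
      \<exists>d>0. \<forall>h. 0 < h \<and> h < d \<longrightarrow> norm (integral {x..x + h} g /\<^sub>R h - g x) < e"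
    using integrable_ccontinuous_explicit[of g] int by auto
  have "(\<lambda>x. g (- x)) integrable_on {a..b}" for a b
    using Henstock_Kurzweil_Integration.integrable_reflect_real[of g "-a" "-b"] int by simp
  then obtain N2 where N2: "negligible N2" "\<And>x e. x \<notin> N2 \<Longrightarrow> 0 < e \<Longrightarrow>
      \<exists>d>0. \<forall>h. 0 < h \<and> h < d \<longrightarrow> norm (integral {x..x + h} (\<lambda>x. g (- x)) /\<^sub>R h - g (- x)) < e"
    using integrable_ccontinuous_explicit[of "\<lambda>x. g (- x)"] by auto
  define N where "N = N1 \<union> uminus ` N2"
  have "negligible (uminus ` N2)"
    by (rule negligible_differentiable_image_negligible[OF _ N2(1)]) (auto intro!: derivative_intros)
  then have "negligible N" using N1(1) by (simp add: N_def)
  moreover have "((\<lambda>u. integral {a..u} g) has_vector_derivative g t) (at t)" if t: "t \<notin> N" "a < t" for t a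
    unfolding has_vector_derivative_def has_derivative_within_alt
  proof (intro conjI allI impI)
    show "bounded_linear (\<lambda>x. x *\<^sub>R g t)" by (rule bounded_linear_scaleR_left)
    fix e :: real assume e: "0 < e"
    have "t \<notin> N1" "- t \<notin> N2" using t by (force simp: N_def)+
    then obtain d1 d2 where d1: "d1 > 0" "\<And>h. 0 < h \<Longrightarrow> h < d1 \<Longrightarrow> norm (integral {t..t + h} g /\<^sub>R h - g t) < e"
      and d2: "d2 > 0" "\<And>h. 0 < h \<Longrightarrow> h < d2 \<Longrightarrow> norm (integral {-t..-t + h} (\<lambda>x. g (- x)) /\<^sub>R h - g t) < e"
      using N1(2)[of t e] N2(2)[of "- t" e] e by auto
    have incr: "integral {a..v} g - integral {a..u} g = integral {u..v} g" if "a \<le> u" "u \<le> v" for u v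
      using Henstock_Kurzweil_Integration.integral_combine[of a u v g] int that by (simp add: algebra_simps)
    have scale: "norm (I - h *\<^sub>R g t) \<le> e * h" if "0 < h" "norm (I /\<^sub>R h - g t) < e" for I h
    proof -
      have "I - h *\<^sub>R g t = h *\<^sub>R (I /\<^sub>R h - g t)" using that by (simp add: algebra_simps)
      then have "norm (I - h *\<^sub>R g t) = h * norm (I /\<^sub>R h - g t)" using that by simp
      then show ?thesis using that by (simp add: mult.commute)
    qed
    have "norm (integral {a..y} g - integral {a..t} g - (y - t) *\<^sub>R g t) \<le> e * norm (y - t)"
      if y: "norm (y - t) < min (min d1 d2) (t - a)" for y
    proof (cases y t rule: linorder_cases)
      case less
      have "integral {- t..- t + (t - y)} (\<lambda>x. g (- x)) = integral {y..t} g"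
        using Henstock_Kurzweil_Integration.integral_reflect_real[of t y g] by simp
      then have "norm (integral {y..t} g - (t - y) *\<^sub>R g t) \<le> e * (t - y)"
        using scale[of "t - y" "integral {y..t} g"] d2(2)[of "t - y"] less y by simp
      moreover have "integral {a..y} g - integral {a..t} g - (y - t) *\<^sub>R g t = - (integral {y..t} g - (t - y) *\<^sub>R g t)"
        using incr[of y t] less y by (simp add: algebra_simps)
      ultimately show ?thesis using less by (simp add: norm_minus_commute)
    next
      case greater
      have "norm (integral {t..y} g - (y - t) *\<^sub>R g t) \<le> e * (y - t)"
        using scale[of "y - t" "integral {t..y} g"] d1(2)[of "y - t"] greater y by simp
      moreover have "integral {a..y} g - integral {a..t} g - (y - t) *\<^sub>R g t = integral {t..y} g - (y - t) *\<^sub>R g t"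
        using incr[of t y] greater t by simp
      ultimately show ?thesis using greater by simp
    qed simp
    then show "\<exists>d>0. \<forall>y\<in>UNIV. norm (y - t) < d \<longrightarrow>
        norm (integral {a..y} g - integral {a..t} g - (y - t) *\<^sub>R g t) \<le> e * norm (y - t)"
      using d1(1) d2(1) t by (intro exI[of _ "min (min d1 d2) (t - a)"]) auto
  qed
  ultimately show ?thesis by (rule that)
qed

text \<open>
  Fundamental theorem of calculus for absolutely continuous functions. In a fine tagged division, the
  intervals tagged outside the null set \<open>N\<close> are handled by differentiability, as for an everywhere
  differentiable function. The gauge forces those tagged in \<open>N\<close> into an open set of small
  measure, and absolute continuity bounds their total contribution to the increment.
\<close>
lemma abs_continuous_imp_has_integral:
  fixes g g' :: "real \<Rightarrow> 'a::euclidean_space"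
  assumes "a \<le> b" and ac: "abs_continuous_on_interval a b g" and N: "negligible N"
    and der: "\<And>t. t \<in> {a..b} - N \<Longrightarrow> (g has_vector_derivative g' t) (at t within {a..b})"
  shows "(g' has_integral (g b - g a)) {a..b}"
proof -
  \<comment> \<open>The integrand may be arbitrary on \<open>N\<close>; with value 0 the terms tagged in \<open>N\<close> are increments of \<open>g\<close> only.\<close>
  let ?h = "\<lambda>t. if t \<in> N then 0 else g' t"
  have "(?h has_integral (g b - g a)) {a..b}"
    unfolding has_integral_real
  proof (intro allI impI)
    fix e :: real assume e: "e > 0"
    obtain \<delta> where \<delta>: "\<delta> > 0" and ac\<delta>: "\<And>P. finite P \<Longrightarrow> (\<forall>(u, v)\<in>P. a \<le> u \<and> u \<le> v \<and> v \<le> b) \<Longrightarrow>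
        disjoint_family_on (\<lambda>(u, v). {u<..<v}) P \<Longrightarrow>
        (\<Sum>(u, v)\<in>P. v - u) < \<delta> \<Longrightarrow> (\<Sum>(u, v)\<in>P. norm (g v - g u)) < e/2"
      using ac[unfolded abs_continuous_on_interval_def, rule_format, of "e/2"] e by auto
    have "N \<in> sets lebesgue" using N by (simp add: negligible_imp_sets)
    then obtain U where U: "open U" "N \<subseteq> U" "U - N \<in> lmeasurable" "emeasure lebesgue (U - N) < ennreal \<delta>"
      using sets_lebesgue_outer_open[OF _ \<delta>] by blast
    have Um: "U \<in> lmeasurable"
    proof -
      have "U = (U - N) \<union> N" using U(2) by auto
      then show ?thesis using U(3) N by (metis fmeasurable.Un negligible_imp_measurable)
    qed
    have "measure lebesgue U = measure lebesgue (U - N)"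
      using N Um by (metis fmeasurableD measure_Diff_null_set negligible_iff_null_sets)
    also have "\<dots> < \<delta>"
      using U(3,4) \<delta> by (simp add: emeasure_eq_measure2 ennreal_less_iff)
    finally have U\<delta>: "measure lebesgue U < \<delta>" .
    \<comment> \<open>The summand 1 keeps the denominator positive when \<open>a = b\<close>.\<close>
    define e' where "e' = e / (2 * (b - a + 1))"
    have e': "e' > 0" using e \<open>a \<le> b\<close> by (simp add: e'_def)
    have "\<exists>d>0. \<forall>y\<in>{a..b}. \<bar>y - t\<bar> < d \<longrightarrow> norm (g y - g t - (y - t) *\<^sub>R g' t) \<le> e' * \<bar>y - t\<bar>"
      if "t \<in> {a..b} - N" for t
      using der[OF that] e' unfolding has_vector_derivative_def has_derivative_within_alt by auto
    then obtain d where d: "\<And>t. t \<in> {a..b} - N \<Longrightarrow> d t > 0 \<and>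
        (\<forall>y\<in>{a..b}. \<bar>y - t\<bar> < d t \<longrightarrow> norm (g y - g t - (y - t) *\<^sub>R g' t) \<le> e' * \<bar>y - t\<bar>)"
      by metis
    define \<gamma> where "\<gamma> t = (if t \<in> N then U else if t \<in> {a..b} then ball t (d t) else ball t 1)" for t
    have "gauge \<gamma>"
      unfolding gauge_def \<gamma>_def using U(1,2) d by auto
    moreover have "norm ((\<Sum>(x, k)\<in>p. measure lborel k *\<^sub>R ?h x) - (g b - g a)) < e"
      if p: "p tagged_division_of {a..b}" and fine: "\<gamma> fine p" for p
    proof -
      note pD = tagged_division_ofD[OF p]
      have ivl: "a \<le> Inf k \<and> Inf k \<le> x \<and> x \<le> Sup k \<and> Sup k \<le> b \<and> k = {Inf k..Sup k}
          \<and> measure lborel k = Sup k - Inf k \<and> interior k = {Inf k<..<Sup k}"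
        if xk: "(x, k) \<in> p" for x k
      proof -
        obtain u v where uv: "k = {u..v}" using pD(4)[OF xk] by auto
        have "u \<le> v" using pD(2)[OF xk] uv by auto
        then show ?thesis using uv pD(2,3)[OF xk] by (auto simp: subset_iff)
      qed
      define D where "D = (\<lambda>(x::real, k). measure lborel k *\<^sub>R ?h x - (g (Sup k) - g (Inf k)))"
      have "(\<Sum>(x, k)\<in>p. measure lborel k *\<^sub>R ?h x) - (g b - g a) = (\<Sum>z\<in>p. D z)"
        unfolding additive_tagged_division_1[OF \<open>a \<le> b\<close> p, symmetric] D_def
        by (simp add: sum_subtractf case_prod_beta)
      also have "\<dots> = (\<Sum>z\<in>{z\<in>p. fst z \<notin> N}. D z) + (\<Sum>z\<in>{z\<in>p. fst z \<in> N}. D z)"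
        by (subst sum.union_disjoint[symmetric]) (auto simp: pD(1) intro!: sum.cong)
      finally have split: "(\<Sum>(x, k)\<in>p. measure lborel k *\<^sub>R ?h x) - (g b - g a) = \<dots>" .
      have "norm (\<Sum>z\<in>{z\<in>p. fst z \<notin> N}. D z) \<le> (\<Sum>z\<in>{z\<in>p. fst z \<notin> N}. e' * measure lborel (snd z))"
      proof (rule sum_norm_le)
        fix z assume z: "z \<in> {z\<in>p. fst z \<notin> N}"
        obtain x k where zxk: "z = (x, k)" by (cases z)
        then have xk: "(x, k) \<in> p" "x \<notin> N" using z by auto
        note I = ivl[OF xk(1)]
        have x: "x \<in> {a..b} - N" using I xk by auto
        have "k \<subseteq> \<gamma> x" using fine xk(1) unfolding fine_def by blast
        then have "k \<subseteq> ball x (d x)" using x by (simp add: \<gamma>_def)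
        moreover have "Inf k \<in> k" "Sup k \<in> k" using I by (metis atLeastAtMost_iff order.refl order_trans)+
        ultimately have "\<bar>Inf k - x\<bar> < d x" "\<bar>Sup k - x\<bar> < d x"
          by (auto simp: dist_real_def subset_iff abs_minus_commute)
        moreover have "Inf k \<in> {a..b}" "Sup k \<in> {a..b}" using I by auto
        ultimately have *: "norm (g (Inf k) - g x - (Inf k - x) *\<^sub>R g' x) \<le> e' * (x - Inf k)"
           "norm (g (Sup k) - g x - (Sup k - x) *\<^sub>R g' x) \<le> e' * (Sup k - x)"
          using d[OF x] I by (metis abs_of_nonneg abs_minus_commute diff_ge_0_iff_ge)+
        have "D z = (g (Inf k) - g x - (Inf k - x) *\<^sub>R g' x) - (g (Sup k) - g x - (Sup k - x) *\<^sub>R g' x)"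
        proof -
          have "measure lborel k = Sup k - Inf k" using I by blast
          then have "D z = (Sup k - Inf k) *\<^sub>R g' x - (g (Sup k) - g (Inf k))"
            using xk by (simp add: zxk D_def)
          then show ?thesis by (simp add: algebra_simps)
        qed
        then have "norm (D z) \<le> e' * (x - Inf k) + e' * (Sup k - x)"
          using * norm_triangle_ineq4[of "g (Inf k) - g x - (Inf k - x) *\<^sub>R g' x" "g (Sup k) - g x - (Sup k - x) *\<^sub>R g' x"]
          by simp
        also have "\<dots> = e' * (Sup k - Inf k)" by (simp add: algebra_simps)
        also have "Sup k - Inf k = measure lborel (snd z)" using I by (simp add: zxk)
        finally show "norm (D z) \<le> e' * measure lborel (snd z)" .
      qed
      also have "\<dots> \<le> (\<Sum>z\<in>p. e' * measure lborel (snd z))"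
        using e' by (intro sum_mono2 pD(1)) (auto simp: content_pos_le)
      also have "\<dots> = e' * (b - a)"
        using additive_content_tagged_division[of p a b] p \<open>a \<le> b\<close>
        by (simp add: sum_distrib_left[symmetric] case_prod_beta)
      also have "\<dots> \<le> e / 2"
        using e \<open>a \<le> b\<close> by (simp add: e'_def field_simps)
      finally have good: "norm (\<Sum>z\<in>{z\<in>p. fst z \<notin> N}. D z) \<le> e / 2" .
      \<comment> \<open>Degenerate intervals contribute nothing; without them an interval determines its tag, so that
        sums over tagged intervals and over sets of pairs of endpoints agree.\<close>
      define Q where "Q = {z\<in>p. fst z \<in> N \<and> Inf (snd z) < Sup (snd z)}"
      define \<iota> where "\<iota> = (\<lambda>z::real \<times> real set. (Inf (snd z), Sup (snd z)))"
      have finQ: "finite Q" using pD(1) by (simp add: Q_def)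
      have disjQ: "{Inf (snd z)<..<Sup (snd z)} \<inter> {Inf (snd w)<..<Sup (snd w)} = {}"
        if "z \<in> Q" "w \<in> Q" "z \<noteq> w" for z w
        using that pD(5)[of "fst z" "snd z" "fst w" "snd w"] ivl[of "fst z" "snd z"] ivl[of "fst w" "snd w"]
        by (auto simp: Q_def prod_eq_iff)
      have inj: "inj_on \<iota> Q"
      proof (rule inj_onI, rule ccontr)
        fix z w assume zw: "z \<in> Q" "w \<in> Q" "\<iota> z = \<iota> w" "z \<noteq> w"
        from disjQ[OF zw(1,2,4)] zw(3) have "{Inf (snd z)<..<Sup (snd z)} = {}" by (auto simp: \<iota>_def)
        then show False using zw(1) by (auto simp: Q_def)
      qed
      have "(\<Sum>(u, v)\<in>\<iota> ` Q. norm (g v - g u)) < e / 2"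
      proof (rule ac\<delta>)
        show "finite (\<iota> ` Q)" using finQ by simp
        show "\<forall>(u, v)\<in>\<iota> ` Q. a \<le> u \<and> u \<le> v \<and> v \<le> b"
          using ivl by (fastforce simp: \<iota>_def Q_def)
        show "disjoint_family_on (\<lambda>(u, v). {u<..<v}) (\<iota> ` Q)"
          unfolding disjoint_family_on_def using disjQ by (fastforce simp: \<iota>_def)
        have "(\<Sum>(u, v)\<in>\<iota> ` Q. v - u) = (\<Sum>z\<in>Q. measure lebesgue {Inf (snd z)<..<Sup (snd z)})"
          unfolding sum.reindex[OF inj] by (auto simp: \<iota>_def Q_def intro!: sum.cong)
        also have "\<dots> = measure lebesgue (\<Union>z\<in>Q. {Inf (snd z)<..<Sup (snd z)})"
          by (rule measure_UNION'[symmetric]) (use finQ disjQ in \<open>auto simp: pairwise_def disjnt_def\<close>)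
        also have "\<dots> \<le> measure lebesgue U"
        proof (rule measure_mono_fmeasurable)
          show "(\<Union>z\<in>Q. {Inf (snd z)<..<Sup (snd z)}) \<subseteq> U"
          proof (rule UN_least)
            fix z assume z: "z \<in> Q"
            then have "snd z \<subseteq> \<gamma> (fst z)" using fine unfolding fine_def Q_def by (cases z) auto
            then have "snd z \<subseteq> U" using z by (simp add: Q_def \<gamma>_def)
            moreover have "{Inf (snd z)<..<Sup (snd z)} \<subseteq> snd z"
              using ivl[of "fst z" "snd z"] z by (auto simp: Q_def intro: interior_subset[THEN subsetD])
            ultimately show "{Inf (snd z)<..<Sup (snd z)} \<subseteq> U" by blast
          qed
        qed (use Um finQ in \<open>auto intro!: sets.finite_UN\<close>)
        also note U\<delta>
        finally show "(\<Sum>(u, v)\<in>\<iota> ` Q. v - u) < \<delta>" .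
      qed
      then have bad': "(\<Sum>z\<in>Q. norm (D z)) < e / 2"
        unfolding sum.reindex[OF inj]
        by (simp add: \<iota>_def D_def Q_def norm_minus_commute case_prod_beta)
      have "norm (\<Sum>z\<in>{z\<in>p. fst z \<in> N}. D z) \<le> (\<Sum>z\<in>{z\<in>p. fst z \<in> N}. norm (D z))"
        by (rule norm_sum)
      also have "\<dots> = (\<Sum>z\<in>Q. norm (D z))"
      proof (rule sum.mono_neutral_right)
        show "\<forall>z\<in>{z\<in>p. fst z \<in> N} - Q. norm (D z) = 0"
        proof
          fix z assume z: "z \<in> {z\<in>p. fst z \<in> N} - Q"
          then have "Inf (snd z) = Sup (snd z)" using ivl[of "fst z" "snd z"] by (auto simp: Q_def)
          then show "norm (D z) = 0" using z by (auto simp: D_def case_prod_beta)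
        qed
      qed (auto simp: Q_def pD(1))
      finally have "norm (\<Sum>z\<in>{z\<in>p. fst z \<in> N}. D z) < e / 2" using bad' by simp
      with good show ?thesis unfolding split
        using norm_triangle_ineq[of "\<Sum>z\<in>{z\<in>p. fst z \<notin> N}. D z" "\<Sum>z\<in>{z\<in>p. fst z \<in> N}. D z"] by linarith
    qed
    ultimately show "\<exists>\<gamma>. gauge \<gamma> \<and> (\<forall>p. p tagged_division_of {a..b} \<and> \<gamma> fine p \<longrightarrow>
        norm ((\<Sum>(x, k)\<in>p. measure lborel k *\<^sub>R ?h x) - (g b - g a)) < e)"
      by (intro exI[of _ \<gamma>] conjI allI impI) auto
  qed
  then show ?thesis by (rule has_integral_spike[OF N, rotated]) auto
qed

section \<open>Integral equations with a Lipschitz right-hand side\<close>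

text \<open>
  The contraction estimate. Against the weight \<open>exp (c t)\<close> with \<open>c = 2 L + 1\<close>, integrating \<open>L\<close> times
  the weight gains the factor \<open>L / c \<le> 1 / 2\<close>, uniformly in the length of the interval.
  The choice \<open>c = 2 L\<close> would fail for \<open>L = 0\<close>.
\<close>
lemma has_integral_norm_le_exp:
  fixes w :: "real \<Rightarrow> 'a::euclidean_space"
  assumes "(w has_integral I) {0..t}" "0 \<le> t" "0 \<le> L" "0 \<le> C"
    and w: "\<And>s. s \<in> {0..t} \<Longrightarrow> norm (w s) \<le> L * (C * exp ((2 * L + 1) * s))"
  shows "norm I \<le> C / 2 * exp ((2 * L + 1) * t)"
proof -
  let ?c = "2 * L + 1"
  have "((\<lambda>s. L * (C * exp (?c * s))) has_integral (L * C / ?c * exp (?c * t) - L * C / ?c * exp (?c * 0))) {0..t}"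
    by (rule fundamental_theorem_of_calculus)
      (use assms in \<open>auto intro!: derivative_eq_intros simp: has_real_derivative_iff_has_vector_derivative[symmetric]\<close>)
  then have "norm I \<le> L * C / ?c * exp (?c * t) - L * C / ?c * exp (?c * 0)"
    using integral_norm_bound_integral[of w "{0..t}" "\<lambda>s. L * (C * exp (?c * s))"] assms(1) w
    by (auto simp: has_integral_iff)
  also have "\<dots> \<le> L * C / ?c * exp (?c * t)" using assms by simp
  also have "\<dots> \<le> C / 2 * exp (?c * t)"
    using assms by (intro mult_right_mono) (auto simp: field_simps)
  finally show ?thesis .
qed

text \<open>
  Two solutions differ by at most \<open>C0 (1/2) ^ n exp (c t)\<close> for every \<open>n\<close>, by repeated use of the
  contraction estimate. The integrands are arbitrary functions of time, compared only outside
  a null set, so that the lemma also compares solutions for two controls that agree almost everywhere.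
\<close>
lemma integral_equation_unique:
  fixes X Y :: "real \<Rightarrow> 'a::euclidean_space"
  assumes X: "\<And>t. t \<in> {0..T} \<Longrightarrow> (F has_integral (X t - x)) {0..t}"
    and Y: "\<And>t. t \<in> {0..T} \<Longrightarrow> (G has_integral (Y t - x)) {0..t}"
    and cont: "continuous_on {0..T} X" "continuous_on {0..T} Y"
    and N: "negligible N" and "0 \<le> L"
    and Lip: "\<And>s. s \<in> {0..T} - N \<Longrightarrow> norm (F s - G s) \<le> L * norm (X s - Y s)"
    and t: "t \<in> {0..T}"
  shows "X t = Y t"
proof -
  have "continuous_on {0..T} (\<lambda>s. X s - Y s)" by (intro continuous_intros cont)
  from compact_imp_bounded[OF compact_continuous_image[OF this]]
  obtain C0 where C0: "\<And>s. s \<in> {0..T} \<Longrightarrow> norm (X s - Y s) \<le> C0"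
    by (force simp: bounded_iff)
  have "0 \<le> C0" using C0[OF t] norm_ge_zero order_trans by blast
  have bound: "norm (X s - Y s) \<le> C0 * (1/2) ^ n * exp ((2 * L + 1) * s)" if "s \<in> {0..T}" for n s
    using that
  proof (induction n arbitrary: s)
    case 0
    have "1 \<le> exp ((2 * L + 1) * s)" using 0 \<open>0 \<le> L\<close> by simp
    then have "C0 * 1 \<le> C0 * exp ((2 * L + 1) * s)" using \<open>0 \<le> C0\<close> by (rule mult_left_mono)
    then show ?case using C0[OF 0] by simp
  next
    case (Suc n)
    define w where "w r = (if r \<in> N then 0 else F r - G r)" for r
    have "((\<lambda>r. F r - G r) has_integral (X s - Y s)) {0..s}"
      using has_integral_diff[OF X[OF Suc.prems] Y[OF Suc.prems]] by simp
    then have "(w has_integral (X s - Y s)) {0..s}"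
      by (rule has_integral_spike[OF N, rotated]) (simp add: w_def)
    moreover have "norm (w r) \<le> L * (C0 * (1/2) ^ n * exp ((2 * L + 1) * r))" if "r \<in> {0..s}" for r
    proof -
      have r: "r \<in> {0..T}" using that Suc.prems by auto
      have "L * norm (X r - Y r) \<le> L * (C0 * (1/2) ^ n * exp ((2 * L + 1) * r))"
        using Suc.IH[OF r] \<open>0 \<le> L\<close> by (rule mult_left_mono)
      moreover have "norm (w r) \<le> L * norm (X r - Y r)" using Lip[of r] r \<open>0 \<le> L\<close> by (simp add: w_def)
      ultimately show ?thesis by linarith
    qed
    ultimately show ?case
      using has_integral_norm_le_exp[of w "X s - Y s" s L "C0 * (1/2) ^ n"] Suc.prems \<open>0 \<le> L\<close> \<open>0 \<le> C0\<close>
      by (simp add: mult.assoc)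
  qed
  have "(\<lambda>n. C0 * (1/2) ^ n * exp ((2 * L + 1) * t)) \<longlonglongrightarrow> C0 * 0 * exp ((2 * L + 1) * t)"
    by (intro tendsto_intros LIMSEQ_power_zero) simp
  then have "norm (X t - Y t) \<le> C0 * 0 * exp ((2 * L + 1) * t)"
    by (rule LIMSEQ_le_const) (use bound[OF t] in blast)
  then show ?thesis by simp
qed

text \<open>
  Picard iteration. By the contraction estimate consecutive iterates differ by at most
  \<open>M (1/2) ^ n exp (c t)\<close>, so they converge pointwise. As the integrands are bounded by \<open>M\<close>,
  dominated convergence turns pointwise convergence into the integral equation for the limit.
\<close>
lemma integral_equation_exists:
  fixes F :: "real \<Rightarrow> 'a::euclidean_space \<Rightarrow> 'a"
  assumes int: "\<And>X t. continuous_on {0..} X \<Longrightarrow> 0 \<le> t \<Longrightarrow> (\<lambda>s. F s (X s)) integrable_on {0..t}"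
    and Lip: "\<And>s y z. 0 \<le> s \<Longrightarrow> norm (F s y - F s z) \<le> L * norm (y - z)"
    and bnd: "\<And>s y. 0 \<le> s \<Longrightarrow> norm (F s y) \<le> M"
    and "0 \<le> L"
  obtains X where "\<And>t. 0 \<le> t \<Longrightarrow> ((\<lambda>s. F s (X s)) has_integral (X t - x)) {0..t}"
proof -
  have M: "0 \<le> M" using bnd[of 0 0] norm_ge_zero order_trans by blast
  define P where "P X t = x + integral {0..t} (\<lambda>s. F s (X s))" for X t
  have P_int: "((\<lambda>s. F s (X s)) has_integral (P X t - x)) {0..t}" if "continuous_on {0..} X" "0 \<le> t" for X t
    using int[OF that] by (simp add: P_def has_integral_iff)
  have P_cont: "continuous_on {0..} (P X)" if X: "continuous_on {0..} X" for X
    using indefinite_integral_lipschitz[of "\<lambda>s. F s (X s)" "P X" x, OF P_int[OF X]] bnd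
    by (intro lipschitz_on_continuous_on) auto
  define Xs where "Xs n = (P ^^ n) (\<lambda>_. x)" for n
  have Xs_Suc: "Xs (Suc n) = P (Xs n)" for n by (simp add: Xs_def)
  have Xs_cont: "continuous_on {0..} (Xs n)" for n
    by (induction n) (auto simp: Xs_Suc P_cont, simp add: Xs_def)
  have step: "norm (Xs (Suc n) t - Xs n t) \<le> M * (1/2) ^ n * exp ((2 * L + 1) * t)" if "0 \<le> t" for n t
    using that
  proof (induction n arbitrary: t)
    case 0
    have "norm (Xs 1 t - x) \<le> M * (t - 0)"
      using P_int[OF Xs_cont[of 0] 0] bnd 0 by (intro has_integral_norm_le_const) (auto simp: Xs_Suc)
    also have "t - 0 \<le> exp ((2 * L + 1) * t)"
    proof -
      have "t \<le> (2 * L + 1) * t" using 0 \<open>0 \<le> L\<close> by (simp add: algebra_simps)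
      also have "\<dots> \<le> exp ((2 * L + 1) * t)" using exp_ge_add_one_self[of "(2 * L + 1) * t"] by linarith
      finally show ?thesis by simp
    qed
    finally show ?case using M by (simp add: Xs_def mult_left_mono)
  next
    case (Suc n)
    have "((\<lambda>s. F s (Xs (Suc n) s) - F s (Xs n s)) has_integral ((P (Xs (Suc n)) t - x) - (P (Xs n) t - x))) {0..t}"
      by (intro has_integral_diff P_int Xs_cont Suc.prems)
    then have "((\<lambda>s. F s (Xs (Suc n) s) - F s (Xs n s)) has_integral (Xs (Suc (Suc n)) t - Xs (Suc n) t)) {0..t}"
      by (simp add: Xs_Suc)
    moreover have "norm (F s (Xs (Suc n) s) - F s (Xs n s)) \<le> L * (M * (1/2) ^ n * exp ((2 * L + 1) * s))"
      if "s \<in> {0..t}" for s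
      using that Lip[of s "Xs (Suc n) s" "Xs n s"] mult_left_mono[OF Suc.IH \<open>0 \<le> L\<close>, of s] by auto
    ultimately show ?case
      using has_integral_norm_le_exp[of _ "Xs (Suc (Suc n)) t - Xs (Suc n) t" t L "M * (1/2) ^ n"] Suc.prems \<open>0 \<le> L\<close> M
      by (simp add: mult.assoc)
  qed
  have "\<exists>l. (\<lambda>n. Xs n t) \<longlonglongrightarrow> l" if "0 \<le> t" for t
  proof -
    have "summable (\<lambda>n. M * (1/2::real) ^ n * exp ((2 * L + 1) * t))"
      by (intro summable_mult summable_mult2 summable_geometric) simp
    then have "summable (\<lambda>n. Xs (Suc n) t - Xs n t)"
      by (rule summable_comparison_test') (use step[OF that] in auto)
    then have "(\<lambda>n. \<Sum>i<n. Xs (Suc i) t - Xs i t) \<longlonglongrightarrow> (\<Sum>i. Xs (Suc i) t - Xs i t)"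
      by (rule summable_LIMSEQ)
    then have "(\<lambda>n. Xs n t - Xs 0 t) \<longlonglongrightarrow> (\<Sum>i. Xs (Suc i) t - Xs i t)"
      by (simp add: sum_lessThan_telescope[of "\<lambda>i. Xs i t"])
    from tendsto_add[OF this tendsto_const[of "Xs 0 t"]] show ?thesis by auto
  qed
  then obtain X where X: "\<And>t. 0 \<le> t \<Longrightarrow> (\<lambda>n. Xs n t) \<longlonglongrightarrow> X t" by metis
  have "((\<lambda>s. F s (X s)) has_integral (X t - x)) {0..t}" if t: "0 \<le> t" for t
  proof (rule has_integral_dominated_convergence)
    show "((\<lambda>s. F s (Xs n s)) has_integral (Xs (Suc n) t - x)) {0..t}" for n
      using P_int[OF Xs_cont t] by (simp add: Xs_Suc)
    show "(\<lambda>_. M) integrable_on {0..t}" by (rule integrable_const_ivl)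
    show "\<forall>s\<in>{0..t}. norm (F s (Xs n s)) \<le> M" for n using bnd by auto
    show "(\<lambda>n. Xs (Suc n) t - x) \<longlonglongrightarrow> X t - x"
      by (intro tendsto_diff tendsto_const LIMSEQ_Suc X t)
    show "\<forall>s\<in>{0..t}. (\<lambda>n. F s (Xs n s)) \<longlonglongrightarrow> F s (X s)"
    proof
      fix s assume s: "s \<in> {0..t}"
      have "(\<lambda>n. L * norm (Xs n s - X s)) \<longlonglongrightarrow> L * norm (X s - X s)"
        using s by (intro tendsto_intros X) auto
      then have lim: "(\<lambda>n. L * norm (Xs n s - X s)) \<longlonglongrightarrow> 0" by simp
      have "(\<lambda>n. F s (Xs n s) - F s (X s)) \<longlonglongrightarrow> 0"
        by (rule Lim_null_comparison[OF _ lim]) (intro always_eventually allI Lip, use s in simp)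
      then show "(\<lambda>n. F s (Xs n s)) \<longlonglongrightarrow> F s (X s)" by (rule LIM_zero_cancel)
    qed
  qed
  then show ?thesis by (rule that)
qed

section \<open>Finite-valued measurable selections\<close>

text \<open>
  If a choice that is good at \<open>k\<close> stays good near \<open>k\<close>, finitely many balls cover the compact set,
  and choosing by the first ball that contains the point is Borel measurable. Measurability into a
  counting space allows composition with any function of the chosen value.
\<close>
lemma compact_finite_valued_selection:
  fixes K :: "'a::metric_space set" and C :: "'c set"
  assumes "compact K" "C \<noteq> {}"
    and loc: "\<And>k. k \<in> K \<Longrightarrow> \<exists>c\<in>C. \<exists>r>0. \<forall>k'\<in>K \<inter> ball k r. P k' c"
  obtains \<phi> where "\<phi> \<in> borel \<rightarrow>\<^sub>M count_space UNIV" "finite (range \<phi>)" "range \<phi> \<subseteq> C"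
    "\<And>k. k \<in> K \<Longrightarrow> P k (\<phi> k)"
proof -
  obtain c r where cr: "\<And>k. k \<in> K \<Longrightarrow> c k \<in> C \<and> r k > 0 \<and> (\<forall>k'\<in>K \<inter> ball k (r k). P k' (c k))"
    using loc by metis
  have "K \<subseteq> (\<Union>k\<in>K. ball k (r k))" using cr by force
  then obtain F where F: "F \<subseteq> K" "finite F" "K \<subseteq> (\<Union>k\<in>F. ball k (r k))"
    using compactE_image[OF \<open>compact K\<close>, of K "\<lambda>k. ball k (r k)"] by (metis open_ball)
  have "\<exists>\<phi>. \<phi> \<in> borel \<rightarrow>\<^sub>M count_space UNIV \<and> finite (range \<phi>) \<and> range \<phi> \<subseteq> C \<and>
      (\<forall>k'\<in>K \<inter> (\<Union>k\<in>F. ball k (r k)). P k' (\<phi> k'))"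
    using F(2,1)
  proof (induction F)
    case empty
    obtain d where "d \<in> C" using \<open>C \<noteq> {}\<close> by blast
    then show ?case by (intro exI[of _ "\<lambda>_. d"]) auto
  next
    case (insert k F)
    then obtain \<phi> where \<phi>: "\<phi> \<in> borel \<rightarrow>\<^sub>M count_space UNIV" "finite (range \<phi>)" "range \<phi> \<subseteq> C"
      "\<forall>k'\<in>K \<inter> (\<Union>k\<in>F. ball k (r k)). P k' (\<phi> k')" by auto
    let ?\<psi> = "\<lambda>x. if x \<in> ball k (r k) then c k else \<phi> x"
    have "?\<psi> \<in> borel \<rightarrow>\<^sub>M count_space UNIV"
      by (intro measurable_If_set \<phi>) auto
    moreover have "range ?\<psi> \<subseteq> insert (c k) (range \<phi>)" by auto
    then have "finite (range ?\<psi>)" using \<phi>(2) finite_subset by blast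
    moreover have "range ?\<psi> \<subseteq> C" using \<phi>(3) cr insert.prems by auto
    moreover have "\<forall>k'\<in>K \<inter> (\<Union>k\<in>insert k F. ball k (r k)). P k' (?\<psi> k')"
      using \<phi>(4) cr insert.prems by auto
    ultimately show ?case by blast
  qed
  then show ?thesis using that F(3) by blast
qed

text \<open>
  Composition with a finite-valued function of a control reduces measurability to the case of a
  constant action.
\<close>
lemma measurable_compose_finite_valued:
  assumes \<phi>: "\<phi> \<in> borel \<rightarrow>\<^sub>M count_space UNIV" "finite (range \<phi>)" and a: "a \<in> borel_measurable M"
    and g: "\<And>i. i \<in> range \<phi> \<Longrightarrow> (\<lambda>s. g i s) \<in> M \<rightarrow>\<^sub>M N"
  shows "(\<lambda>s. g (\<phi> (a s)) s) \<in> M \<rightarrow>\<^sub>M N"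
proof (rule measurable_compose_countable'[where I="range \<phi>"])
  have "\<phi> \<in> borel \<rightarrow>\<^sub>M count_space (range \<phi>)"
    unfolding measurable_count_space_eq2[OF \<phi>(2)]
    using measurable_sets[OF \<phi>(1)] by auto
  from measurable_compose[OF a this] show "(\<lambda>s. \<phi> (a s)) \<in> M \<rightarrow>\<^sub>M count_space (range \<phi>)" .
qed (use g \<phi>(2) in \<open>auto simp: countable_finite\<close>)

lemma compact_finite_valued_approximation:
  fixes K :: "'a::metric_space set"
  assumes "compact K" "K \<noteq> {}" "0 < e"
  obtains \<phi> where "\<phi> \<in> borel \<rightarrow>\<^sub>M count_space UNIV" "finite (range \<phi>)" "range \<phi> \<subseteq> K"
    "\<And>k. k \<in> K \<Longrightarrow> dist (\<phi> k) k < e"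
proof (rule compact_finite_valued_selection[OF assms(1,2), of "\<lambda>k c. dist c k < e"])
  show "\<exists>c\<in>K. \<exists>r>0. \<forall>k'\<in>K \<inter> ball k r. dist c k' < e" if "k \<in> K" for k
    using that \<open>0 < e\<close> by (intro bexI[of _ k] exI[of _ e]) auto
qed (rule that)

section \<open>Trajectories of the game\<close>

lemma constant_control: "c \<in> C \<Longrightarrow> (\<lambda>s\<in>{0..}. c) \<in> controls C"
proof -
  assume c: "c \<in> C"
  have "(\<lambda>s\<in>{0..}. c) \<in> borel_measurable (lebesgue_on {0::real..}) \<longleftrightarrow>
      (\<lambda>_. c) \<in> borel_measurable (lebesgue_on {0::real..})"
    by (rule measurable_cong) auto
  then show ?thesis using c by (auto simp: controls_def)
qed

context differential_game
begin

text \<open>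
  Fixed choices of the constants of \<open>f\<close>, so that the estimates below can refer to them.
\<close>
definition f_Lip :: real where
  "f_Lip = (SOME L. 0 \<le> L \<and> (\<forall>x y. \<forall>a\<in>A. \<forall>b\<in>B. norm (f x a b - f y a b) \<le> L * norm (x - y)))"

lemma f_Lip_nonneg: "0 \<le> f_Lip"
  and f_Lip: "a \<in> A \<Longrightarrow> b \<in> B \<Longrightarrow> norm (f x a b - f y a b) \<le> f_Lip * norm (x - y)"
proof -
  have "0 \<le> f_Lip \<and> (\<forall>x y. \<forall>a\<in>A. \<forall>b\<in>B. norm (f x a b - f y a b) \<le> f_Lip * norm (x - y))"
    unfolding f_Lip_def using f_Lipschitz by (rule someI_ex)
  then show "0 \<le> f_Lip"
    and "a \<in> A \<Longrightarrow> b \<in> B \<Longrightarrow> norm (f x a b - f y a b) \<le> f_Lip * norm (x - y)" by auto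
qed

text \<open>
  By periodicity all values are attained over the unit cube, and the cube and the action sets are compact.
\<close>
lemma f_bounded: "\<exists>M. \<forall>x. \<forall>a\<in>A. \<forall>b\<in>B. norm (f x a b) \<le> M"
proof -
  let ?Q = "cbox 0 (\<chi> i. 1) :: (real ^ 'n) set"
  have "compact (?Q \<times> A \<times> B)" by (intro compact_Times compact_cbox A_compact B_compact)
  then have "bounded ((\<lambda>(x, a, b). f x a b) ` (?Q \<times> A \<times> B))"
    by (intro compact_imp_bounded compact_continuous_image continuous_on_subset[OF f_continuous]) auto
  then obtain M where M: "\<forall>z\<in>(\<lambda>(x, a, b). f x a b) ` (?Q \<times> A \<times> B). norm z \<le> M"
    unfolding bounded_iff by blast
  have "norm (f x a b) \<le> M" if "a \<in> A" "b \<in> B" for x a b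
  proof -
    define z :: "real ^ 'n" where "z = (\<chi> i. - real_of_int \<lfloor>x $ i\<rfloor>)"
    have "f (x + z) a b = f x a b" using that by (intro f_periodic) (auto simp: z_def)
    moreover have "x + z \<in> ?Q" by (auto simp: mem_box_cart z_def) linarith
    ultimately show ?thesis using M that by force
  qed
  then show ?thesis by blast
qed

definition f_bound :: real where
  "f_bound = (SOME M. \<forall>x. \<forall>a\<in>A. \<forall>b\<in>B. norm (f x a b) \<le> M)"

lemma f_bound:
  assumes "a \<in> A" "b \<in> B"
  shows "norm (f x a b) \<le> f_bound"
proof -
  have "\<forall>x. \<forall>a\<in>A. \<forall>b\<in>B. norm (f x a b) \<le> f_bound"
    unfolding f_bound_def using f_bounded by (rule someI_ex)
  then show ?thesis using assms by simp
qed

lemma f_bound_nonneg: "0 \<le> f_bound"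
proof -
  obtain a b where "a \<in> A" "b \<in> B" using A_nonempty B_nonempty by blast
  from f_bound[OF this, of 0] norm_ge_zero[of "f 0 a b"] show ?thesis by linarith
qed

lemma tendsto_f:
  assumes "(u \<longlongrightarrow> x) F" "(v \<longlongrightarrow> a) F" "(w \<longlongrightarrow> b) F" "a \<in> A" "b \<in> B"
    "\<And>n. v n \<in> A" "\<And>n. w n \<in> B"
  shows "((\<lambda>n. f (u n) (v n) (w n)) \<longlongrightarrow> f x a b) F"
proof -
  have "((\<lambda>n. (u n, v n, w n)) \<longlongrightarrow> (x, a, b)) F" by (intro tendsto_Pair assms)
  then have "((\<lambda>n. (\<lambda>(x, a, b). f x a b) (u n, v n, w n)) \<longlongrightarrow> (\<lambda>(x, a, b). f x a b) (x, a, b)) F"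
    by (rule continuous_on_tendsto_compose[OF f_continuous]) (use assms in \<open>auto intro: always_eventually\<close>)
  then show ?thesis by simp
qed

lemma controlsD:
  assumes "c \<in> controls C"
  shows "0 \<le> s \<Longrightarrow> c s \<in> C" and "c \<in> borel_measurable (lebesgue_on {0..})"
    and "s < 0 \<Longrightarrow> c s = undefined"
  using assms by (auto simp: controls_def PiE_def extensional_def)

text \<open>
  The action spaces need not be second countable as types, so a pair of measurable controls need not
  be measurable into the Borel sets of the product. Instead, the controls are approximated uniformly by
  finite-valued ones, for which the claim reduces to constant actions, and \<open>f\<close> is continuous.
\<close>
lemma measurable_dynamics:
  assumes a: "a \<in> controls A" and b: "b \<in> controls B" and X: "X \<in> borel_measurable (lebesgue_on {0..})"
  shows "(\<lambda>s. f (X s) (a s) (b s)) \<in> borel_measurable (lebesgue_on {0..})"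
proof -
  have "\<exists>\<phi>. \<phi> \<in> borel \<rightarrow>\<^sub>M count_space UNIV \<and> finite (range \<phi>) \<and> range \<phi> \<subseteq> A \<and>
      (\<forall>k\<in>A. dist (\<phi> k) k < inverse (real (Suc n)))" for n
    by (rule compact_finite_valued_approximation[OF A_compact A_nonempty, of "inverse (real (Suc n))"]) auto
  then obtain \<phi> where \<phi>: "\<And>n. \<phi> n \<in> borel \<rightarrow>\<^sub>M count_space UNIV" "\<And>n. finite (range (\<phi> n))"
      "\<And>n. range (\<phi> n) \<subseteq> A" "\<And>n k. k \<in> A \<Longrightarrow> dist (\<phi> n k) k < inverse (real (Suc n))"
    by metis
  have "\<exists>\<psi>. \<psi> \<in> borel \<rightarrow>\<^sub>M count_space UNIV \<and> finite (range \<psi>) \<and> range \<psi> \<subseteq> B \<and>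
      (\<forall>k\<in>B. dist (\<psi> k) k < inverse (real (Suc n)))" for n
    by (rule compact_finite_valued_approximation[OF B_compact B_nonempty, of "inverse (real (Suc n))"]) auto
  then obtain \<psi> where \<psi>: "\<And>n. \<psi> n \<in> borel \<rightarrow>\<^sub>M count_space UNIV" "\<And>n. finite (range (\<psi> n))"
      "\<And>n. range (\<psi> n) \<subseteq> B" "\<And>n k. k \<in> B \<Longrightarrow> dist (\<psi> n k) k < inverse (real (Suc n))"
    by metis
  have conv: "(\<lambda>n. \<theta> n k) \<longlonglongrightarrow> k" if "\<And>n. dist (\<theta> n k) k < inverse (real (Suc n))"
    for \<theta> :: "nat \<Rightarrow> 'z::metric_space \<Rightarrow> 'z" and k
    using that by (intro metric_tendsto_imp_tendsto[OF LIMSEQ_inverse_real_of_nat])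
      (auto intro!: always_eventually less_imp_le)
  show ?thesis
  proof (rule borel_measurable_LIMSEQ_metric)
    fix n
    have "(\<lambda>s. f (X s) i j) \<in> borel_measurable (lebesgue_on {0..})" if "i \<in> A" "j \<in> B" for i j
    proof -
      have "continuous_on UNIV (\<lambda>y. (\<lambda>(x, a, b). f x a b) (y, i, j))"
        by (rule continuous_on_compose2[OF f_continuous]) (use that in \<open>auto intro!: continuous_intros\<close>)
      then have "continuous_on UNIV (\<lambda>y. f y i j)" by simp
      then show ?thesis by (intro measurable_compose[OF X] borel_measurable_continuous_onI)
    qed
    then show "(\<lambda>s. f (X s) (\<phi> n (a s)) (\<psi> n (b s))) \<in> borel_measurable (lebesgue_on {0..})"
      using \<phi>(3)[of n] \<psi>(3)[of n]
      by (intro measurable_compose_finite_valued[OF \<phi>(1,2) controlsD(2)[OF a],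
            where g="\<lambda>i s. f (X s) i (\<psi> n (b s))"]
          measurable_compose_finite_valued[OF \<psi>(1,2) controlsD(2)[OF b],
            where g="\<lambda>j s. f (X s) _ j"]) blast
  next
    fix s :: real assume "s \<in> space (lebesgue_on {0..})"
    then have s: "a s \<in> A" "b s \<in> B" using controlsD(1)[OF a] controlsD(1)[OF b] by auto
    show "(\<lambda>n. f (X s) (\<phi> n (a s)) (\<psi> n (b s))) \<longlonglongrightarrow> f (X s) (a s) (b s)"
      using \<phi>(3) \<psi>(3) by (intro tendsto_f tendsto_const conv \<phi>(4) \<psi>(4) s) blast+
  qed
qed

lemma dynamics_integrable:
  assumes "a \<in> controls A" "b \<in> controls B" "continuous_on {0..} X" "0 \<le> t"
  shows "(\<lambda>s. f (X s) (a s) (b s)) integrable_on {0..t}"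
proof (rule measurable_bounded_by_integrable_imp_integrable)
  have "X \<in> borel_measurable (lebesgue_on {0..})"
    using assms(3) by (intro continuous_imp_measurable_on_sets_lebesgue) auto
  from measurable_restrict_mono[OF measurable_dynamics[OF assms(1,2) this], of "{0..t}"]
  show "(\<lambda>s. f (X s) (a s) (b s)) \<in> borel_measurable (lebesgue_on {0..t})" by auto
  show "(\<lambda>_. f_bound) integrable_on {0..t}" by (rule integrable_const_ivl)
qed (use f_bound controlsD(1)[OF assms(1)] controlsD(1)[OF assms(2)] in auto)

lemma solution_imp_has_integral:
  assumes "solution f x a b X" "0 \<le> t"
  shows "((\<lambda>s. f (X s) (a s) (b s)) has_integral (X t - x)) {0..t}"
proof -
  have X: "X 0 = x" "abs_continuous_on_interval 0 t X"
    "AE t in lebesgue. 0 < t \<longrightarrow> (X has_vector_derivative f (X t) (a t) (b t)) (at t)"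
    using assms by (auto simp: solution_def)
  from X(3) obtain N where N: "negligible N"
      "{t. \<not> (0 < t \<longrightarrow> (X has_vector_derivative f (X t) (a t) (b t)) (at t))} \<subseteq> N"
    unfolding eventually_ae_filter_negligible by (elim exE conjE)
  have "((\<lambda>s. f (X s) (a s) (b s)) has_integral (X t - X 0)) {0..t}"
  proof (rule abs_continuous_imp_has_integral[OF assms(2) X(2)])
    show "negligible (insert 0 N)" using N(1) by simp
    fix s assume "s \<in> {0..t} - insert 0 N"
    then have "0 < s" "s \<notin> N" by auto
    then have "(X has_vector_derivative f (X s) (a s) (b s)) (at s)" using N(2) by blast
    then show "(X has_vector_derivative f (X s) (a s) (b s)) (at s within {0..t})"
      by (rule has_vector_derivative_at_within)
  qed
  then show ?thesis by (simp add: X(1))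
qed

text \<open>
  The integral equation makes \<open>X\<close> Lipschitz with constant \<open>f_bound\<close>, hence absolutely continuous, and
  Lebesgue's differentiation theorem provides the derivative almost everywhere.
\<close>
lemma has_integral_imp_solution:
  assumes a: "a \<in> controls A" and b: "b \<in> controls B"
    and X: "\<And>t. 0 \<le> t \<Longrightarrow> ((\<lambda>s. f (X s) (a s) (b s)) has_integral (X t - x)) {0..t}"
  shows "solution f x a b X"
  unfolding solution_def
proof (intro conjI allI impI)
  show "X 0 = x" using has_integral_degenerate_interval[OF X[OF order_refl]] by simp
  have lip: "f_bound-lipschitz_on {0..} X"
    using indefinite_integral_lipschitz[OF X] f_bound controlsD(1)[OF a] controlsD(1)[OF b] by blast
  show "abs_continuous_on_interval 0 T X" if "0 \<le> T" for T
    unfolding abs_continuous_on_interval_def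
  proof (intro allI impI)
    fix e :: real assume e: "0 < e"
    show "\<exists>d>0. \<forall>P. finite P \<longrightarrow> (\<forall>(u, v)\<in>P. 0 \<le> u \<and> u \<le> v \<and> v \<le> T) \<longrightarrow>
        disjoint_family_on (\<lambda>(u, v). {u<..<v}) P \<longrightarrow>
        (\<Sum>(u, v)\<in>P. v - u) < d \<longrightarrow> (\<Sum>(u, v)\<in>P. norm (X v - X u)) < e"
    proof (intro exI[of _ "e / (f_bound + 1)"] conjI allI impI)
      show "0 < e / (f_bound + 1)" using e f_bound_nonneg by simp
      fix P :: "(real \<times> real) set"
      assume P: "\<forall>(u, v)\<in>P. 0 \<le> u \<and> u \<le> v \<and> v \<le> T" and small: "(\<Sum>(u, v)\<in>P. v - u) < e / (f_bound + 1)"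
      have nn: "0 \<le> (\<Sum>(u, v)\<in>P. v - u)" using P by (intro sum_nonneg) auto
      have "(\<Sum>(u, v)\<in>P. norm (X v - X u)) \<le> (\<Sum>(u, v)\<in>P. f_bound * (v - u))"
      proof (rule sum_mono, clarify)
        fix u v assume "(u, v) \<in> P"
        then have "0 \<le> u" "u \<le> v" using P by auto
        then show "norm (X v - X u) \<le> f_bound * (v - u)"
          using lipschitz_onD[OF lip, of v u] by (simp add: dist_norm)
      qed
      also have "\<dots> = f_bound * (\<Sum>(u, v)\<in>P. v - u)" by (simp add: sum_distrib_left case_prod_beta)
      also have "\<dots> \<le> (f_bound + 1) * (\<Sum>(u, v)\<in>P. v - u)" using nn by (intro mult_right_mono) auto
      also have "\<dots> < e" using small f_bound_nonneg by (simp add: field_simps)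
      finally show "(\<Sum>(u, v)\<in>P. norm (X v - X u)) < e" .
    qed
  qed
  \<comment> \<open>Extended by 0 to negative times, the integrand is integrable on every compact interval.\<close>
  define g where "g s = (if s \<in> {0..} then f (X s) (a s) (b s) else 0)" for s
  have "g integrable_on {u..v}" for u v
  proof -
    have "(\<lambda>s. f (X s) (a s) (b s)) integrable_on {0..max 0 v}"
      using X[of "max 0 v"] by (auto intro: has_integral_integrable)
    then have "(\<lambda>s. f (X s) (a s) (b s)) integrable_on {max 0 u..v}"
      by (rule integrable_on_subinterval) auto
    moreover have "{0..} \<inter> {u..v} = {max 0 u..v}" by auto
    ultimately show ?thesis unfolding g_def integrable_restrict_Int by simp
  qed
  then obtain N where N: "negligible N"
    "\<And>t c. t \<notin> N \<Longrightarrow> c < t \<Longrightarrow> ((\<lambda>u. integral {c..u} g) has_vector_derivative g t) (at t)"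
    using indefinite_integral_has_vector_derivative_AE by blast
  have "(X has_vector_derivative f (X t) (a t) (b t)) (at t)" if t: "0 < t" "t \<notin> N" for t
  proof (rule has_vector_derivative_transform_within_open)
    have "((\<lambda>u. x + integral {-1..u} g) has_vector_derivative 0 + g t) (at t)"
      using N(2)[of t "-1"] t by (intro has_vector_derivative_add) auto
    then show "((\<lambda>u. x + integral {-1..u} g) has_vector_derivative f (X t) (a t) (b t)) (at t)"
      using t by (simp add: g_def)
    show "open {0::real<..}" "t \<in> {0<..}" using t by auto
    fix u :: real assume u: "u \<in> {0<..}"
    have "integral {-1..u} g = integral ({0..} \<inter> {-1..u}) (\<lambda>s. f (X s) (a s) (b s))"
      unfolding g_def by (rule Henstock_Kurzweil_Integration.integral_restrict_Int)
    also have "{0..} \<inter> {-1..u} = {0..u}" by auto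
    also have "integral {0..u} (\<lambda>s. f (X s) (a s) (b s)) = X u - x"
      using X[of u] u by (auto intro: integral_unique)
    finally show "x + integral {-1..u} g = X u" by simp
  qed
  then show "AE t in lebesgue. 0 < t \<longrightarrow> (X has_vector_derivative f (X t) (a t) (b t)) (at t)"
    unfolding eventually_ae_filter_negligible by (intro exI[of _ N]) (use N(1) in auto)
qed

lemma has_integral_solution_unique:
  assumes a: "a \<in> controls A" "a' \<in> controls A" and b: "b \<in> controls B" "b' \<in> controls B"
    and X: "\<And>t. 0 \<le> t \<Longrightarrow> ((\<lambda>s. f (X s) (a s) (b s)) has_integral (X t - x)) {0..t}"
    and Y: "\<And>t. 0 \<le> t \<Longrightarrow> ((\<lambda>s. f (Y s) (a' s) (b' s)) has_integral (Y t - x)) {0..t}"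
    and t: "0 \<le> t"
    and eq: "AE s in lebesgue_on {0..t}. a s = a' s" "AE s in lebesgue_on {0..t}. b s = b' s"
  shows "X t = Y t"
proof -
  obtain N1 N2 where N: "negligible N1" "\<And>s. s \<in> {0..t} - N1 \<Longrightarrow> a s = a' s"
    "negligible N2" "\<And>s. s \<in> {0..t} - N2 \<Longrightarrow> b s = b' s"
    using eq unfolding AE_lebesgue_on_negligible by blast
  have cont: "continuous_on {0..t} X" "continuous_on {0..t} Y"
    using indefinite_integral_lipschitz[OF X, of f_bound] indefinite_integral_lipschitz[OF Y, of f_bound]
      f_bound controlsD(1)[OF a(1)] controlsD(1)[OF b(1)] controlsD(1)[OF a(2)] controlsD(1)[OF b(2)]
    by (auto intro!: continuous_on_subset[OF lipschitz_on_continuous_on])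
  show ?thesis
  proof (rule integral_equation_unique[OF X Y cont, of "N1 \<union> N2" f_Lip])
    show "negligible (N1 \<union> N2)" using N by simp
    show "norm (f (X s) (a s) (b s) - f (Y s) (a' s) (b' s)) \<le> f_Lip * norm (X s - Y s)"
      if "s \<in> {0..t} - (N1 \<union> N2)" for s
    proof -
      have "a' s = a s" "b' s = b s" using that N by auto
      then show ?thesis using f_Lip[OF controlsD(1)[OF a(1)] controlsD(1)[OF b(1)]] that by auto
    qed
  qed (use t f_Lip_nonneg in auto)
qed

text \<open>
  Solutions exist and are unique on \<open>[0,\<infinity>)\<close>, so the description in the definition of \<open>trajectory\<close>
  denotes the value of the solution. From here on only this equation is used.
\<close>
lemma trajectory_has_integral:
  assumes a: "a \<in> controls A" and b: "b \<in> controls B" and t: "0 \<le> t"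
  shows "((\<lambda>s. f (trajectory f x a b s) (a s) (b s)) has_integral (trajectory f x a b t - x)) {0..t}"
proof -
  note ab = controlsD(1)[OF a] controlsD(1)[OF b]
  obtain X where X: "\<And>t. 0 \<le> t \<Longrightarrow> ((\<lambda>s. f (X s) (a s) (b s)) has_integral (X t - x)) {0..t}"
  proof (rule integral_equation_exists[of "\<lambda>s y. f y (a s) (b s)" f_Lip f_bound x])
  qed (use dynamics_integrable[OF a b] f_Lip[OF ab] f_bound[OF ab] f_Lip_nonneg in auto)
  have "trajectory f x a b s = X s" if "0 \<le> s" for s
    unfolding trajectory_def
  proof (rule the_equality)
    show "\<exists>X'. solution f x a b X' \<and> X' s = X s"
      using has_integral_imp_solution[OF a b X] by blast
    fix y assume "\<exists>X'. solution f x a b X' \<and> X' s = y"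
    then obtain X' where X': "solution f x a b X'" "X' s = y" by blast
    show "y = X s"
      using has_integral_solution_unique[OF a a b b solution_imp_has_integral[OF X'(1)] X that] X'(2) by simp
  qed
  with X[OF t] t show ?thesis by (auto intro: has_integral_eq[rotated])
qed

lemma trajectory_0: "a \<in> controls A \<Longrightarrow> b \<in> controls B \<Longrightarrow> trajectory f x a b 0 = x"
  using has_integral_degenerate_interval[OF trajectory_has_integral[of a b 0 x]] by simp

text \<open>
  The state at time \<open>t\<close> depends only on the controls up to \<open>t\<close>, modulo null sets. This is what makes
  feedback on the current state nonanticipating.
\<close>
lemma trajectory_causal:
  assumes "a \<in> controls A" "a' \<in> controls A" "b \<in> controls B" "b' \<in> controls B" "0 \<le> t"
    and "AE s in lebesgue_on {0..t}. a s = a' s" "AE s in lebesgue_on {0..t}. b s = b' s"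
  shows "trajectory f x a b t = trajectory f x a' b' t"
  by (rule has_integral_solution_unique[OF assms(1-4) trajectory_has_integral trajectory_has_integral])
    (use assms in auto)

lemma trajectory_lipschitz:
  assumes "a \<in> controls A" "b \<in> controls B"
  shows "f_bound-lipschitz_on {0..} (trajectory f x a b)"
  using indefinite_integral_lipschitz[OF trajectory_has_integral[OF assms]]
    f_bound controlsD(1)[OF assms(1)] controlsD(1)[OF assms(2)] by blast

lemma trajectory_increment:
  assumes "a \<in> controls A" "b \<in> controls B" "0 \<le> s" "s \<le> t"
  shows "((\<lambda>r. f (trajectory f x a b r) (a r) (b r)) has_integral
     (trajectory f x a b t - trajectory f x a b s)) {s..t}"
  using has_integral_interval_diff[OF trajectory_has_integral[OF assms(1,2)] assms(3,4), of x] by simp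

lemma trajectory_displacement_le:
  assumes "a \<in> controls A" "b \<in> controls B" "0 \<le> s" "s \<le> t"
  shows "norm (trajectory f x a b t - trajectory f x a b s) \<le> f_bound * (t - s)"
  using lipschitz_onD[OF trajectory_lipschitz[OF assms(1,2), of x], of t s] assms(3,4)
  by (simp add: dist_norm)

text \<open>
  The basic estimate of both directions: freezing the first argument of \<open>f\<close> at a point \<open>q\<close> within
  distance \<open>R\<close> of the trajectory changes the velocity by at most \<open>f_Lip * R\<close>.
\<close>
lemma trajectory_increment_inner_le:
  assumes a: "a \<in> controls A" and b: "b \<in> controls B" and uv: "0 \<le> u" "u \<le> v"
    and c: "\<And>s. s \<in> {u..v} \<Longrightarrow> f q (a s) (b s) \<bullet> p \<le> c"
    and R: "\<And>s. s \<in> {u..v} \<Longrightarrow> norm (trajectory f x a b s - q) \<le> R"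
  shows "(trajectory f x a b v - trajectory f x a b u) \<bullet> p \<le> (c + f_Lip * R * norm p) * (v - u)"
proof -
  let ?X = "trajectory f x a b"
  have "((\<lambda>s. f (?X s) (a s) (b s) \<bullet> p) has_integral ((?X v - ?X u) \<bullet> p)) {u..v}"
    using has_integral_linear[OF trajectory_increment[OF a b uv, of x] bounded_linear_inner_left[of p]]
    by (simp add: o_def)
  moreover have "((\<lambda>_. c + f_Lip * R * norm p) has_integral ((c + f_Lip * R * norm p) * (v - u))) {u..v}"
    using has_integral_const_real[of "c + f_Lip * R * norm p" u v] uv by (simp add: mult.commute)
  moreover have "f (?X s) (a s) (b s) \<bullet> p \<le> c + f_Lip * R * norm p" if s: "s \<in> {u..v}" for s
  proof -
    have ab: "a s \<in> A" "b s \<in> B" using controlsD(1)[OF a] controlsD(1)[OF b] s uv by auto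
    have "(f (?X s) (a s) (b s) - f q (a s) (b s)) \<bullet> p
        \<le> norm (f (?X s) (a s) (b s) - f q (a s) (b s)) * norm p" by (rule norm_cauchy_schwarz)
    also have "\<dots> \<le> f_Lip * norm (?X s - q) * norm p"
      by (intro mult_right_mono f_Lip ab) simp
    also have "\<dots> \<le> f_Lip * R * norm p"
      by (intro mult_right_mono mult_left_mono R s f_Lip_nonneg) simp
    finally show ?thesis using c[OF s] by (simp add: inner_diff_left)
  qed
  ultimately show ?thesis by (rule has_integral_le)
qed

end

section \<open>The minimum and maximum as a statement about replies\<close>

context differential_game
begin

lemma H_inf_nonneg_iff: "0 \<le> H_inf A B f x p \<longleftrightarrow> (\<forall>b\<in>B. \<exists>a\<in>A. f x a b \<bullet> p \<le> 0)"
proof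
  assume H: "0 \<le> H_inf A B f x p"
  show "\<forall>b\<in>B. \<exists>a\<in>A. f x a b \<bullet> p \<le> 0"
  proof
    fix b assume b: "b \<in> B"
    have "H_inf A B f x p \<le> (SUP a\<in>A. - (f x a b \<bullet> p))"
      using H_inf_attained(2)[of x p] b by metis
    moreover obtain a where "a \<in> A" "- (f x a b \<bullet> p) = (SUP a\<in>A. - (f x a b \<bullet> p))"
      using H_inf_attained(1)[of x p] b by blast
    ultimately have "f x a b \<bullet> p \<le> 0" using H by linarith
    then show "\<exists>a\<in>A. f x a b \<bullet> p \<le> 0" using \<open>a \<in> A\<close> by blast
  qed
next
  assume R: "\<forall>b\<in>B. \<exists>a\<in>A. f x a b \<bullet> p \<le> 0"
  obtain b where b: "b \<in> B" "(SUP a\<in>A. - (f x a b \<bullet> p)) = H_inf A B f x p"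
    using H_inf_attained(2)[of x p] by blast
  obtain a where a: "a \<in> A" "- (f x a b \<bullet> p) = (SUP a\<in>A. - (f x a b \<bullet> p))"
      "\<forall>a'\<in>A. - (f x a' b \<bullet> p) \<le> - (f x a b \<bullet> p)"
    using H_inf_attained(1)[of x p] b(1) by blast
  obtain a' where a': "a' \<in> A" "f x a' b \<bullet> p \<le> 0" using R b(1) by blast
  have "- (f x a' b \<bullet> p) \<le> - (f x a b \<bullet> p)" using a(3) a'(1) by blast
  then show "0 \<le> H_inf A B f x p" using a'(2) unfolding b(2)[symmetric] a(2)[symmetric] by linarith
qed

lemma max_min_nonpos_iff: "(SUP b\<in>B. INF a\<in>A. f x a b \<bullet> p) \<le> 0 \<longleftrightarrow> (\<forall>b\<in>B. \<exists>a\<in>A. f x a b \<bullet> p \<le> 0)"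
proof
  assume H: "(SUP b\<in>B. INF a\<in>A. f x a b \<bullet> p) \<le> 0"
  show "\<forall>b\<in>B. \<exists>a\<in>A. f x a b \<bullet> p \<le> 0"
  proof
    fix b assume b: "b \<in> B"
    have "(INF a\<in>A. f x a b \<bullet> p) \<le> (SUP b\<in>B. INF a\<in>A. f x a b \<bullet> p)"
      using max_min_attained(2)[of x p] b by metis
    moreover obtain a where "a \<in> A" "f x a b \<bullet> p = (INF a\<in>A. f x a b \<bullet> p)"
      using max_min_attained(1)[of x p] b by blast
    ultimately have "f x a b \<bullet> p \<le> 0" using H by linarith
    then show "\<exists>a\<in>A. f x a b \<bullet> p \<le> 0" using \<open>a \<in> A\<close> by blast
  qed
next
  assume R: "\<forall>b\<in>B. \<exists>a\<in>A. f x a b \<bullet> p \<le> 0"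
  obtain b where b: "b \<in> B" "(INF a\<in>A. f x a b \<bullet> p) = (SUP b\<in>B. INF a\<in>A. f x a b \<bullet> p)"
    using max_min_attained(2)[of x p] by blast
  obtain a where a: "a \<in> A" "f x a b \<bullet> p = (INF a\<in>A. f x a b \<bullet> p)"
      "\<forall>a'\<in>A. f x a b \<bullet> p \<le> f x a' b \<bullet> p"
    using max_min_attained(1)[of x p] b(1) by blast
  obtain a' where a': "a' \<in> A" "f x a' b \<bullet> p \<le> 0" using R b(1) by blast
  have "f x a b \<bullet> p \<le> f x a' b \<bullet> p" using a(3) a'(1) by blast
  then show "(SUP b\<in>B. INF a\<in>A. f x a b \<bullet> p) \<le> 0"
    using a'(2) unfolding b(2)[symmetric] a(2)[symmetric] by linarith
qed

end

section \<open>Dominions satisfy the proximal condition\<close>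

context differential_game
begin

text \<open>
  Against the constant control \<open>b\<close>, the state at the time \<open>t = \<eta> / c\<close> satisfies
  \<open>(norm (X t - x - p))\<^sup>2 < (norm p)\<^sup>2 - t * \<eta>\<close> for every strategy of player 1. So it lies in the
  ball of radius \<open>norm p\<close> about \<open>x + p\<close> at a depth larger than \<open>\<epsilon>\<close>, while \<open>D\<close> stays outside this ball.
\<close>
lemma dominion_imp_proximal_condition:
  assumes D: "dominion A B f D" and x: "x \<in> D" and p: "p \<in> proximal_normals D x" and b: "b \<in> B"
  shows "\<exists>a\<in>A. f x a b \<bullet> p \<le> 0"
proof (rule ccontr)
  assume "\<not> ?thesis"
  then have pos: "\<And>a. a \<in> A \<Longrightarrow> 0 < f x a b \<bullet> p" by (simp add: not_le)
  obtain a0 where a0: "a0 \<in> A" "\<And>a. a \<in> A \<Longrightarrow> f x a0 b \<bullet> p \<le> f x a b \<bullet> p"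
    using max_min_attained(1)[of x p] b by blast
  define \<eta> where "\<eta> = f x a0 b \<bullet> p"
  have \<eta>: "0 < \<eta>" using pos a0(1) by (simp add: \<eta>_def)
  have "p \<noteq> 0" using \<eta> by (auto simp: \<eta>_def)
  then have P: "0 < norm p" by simp
  \<comment> \<open>The coefficient of \<open>t\<^sup>2\<close> in the expansion of \<open>(norm (X t - x - p))\<^sup>2\<close> is at most \<open>c - 1\<close>, so that at
    \<open>t = \<eta> / c\<close> the linear term \<open>- 2 \<eta> t\<close> prevails with \<open>t \<eta>\<close> to spare.\<close>
  define c where "c = 2 * f_Lip * f_bound * norm p + f_bound\<^sup>2 + 1"
  have c: "1 \<le> c" using f_Lip_nonneg f_bound_nonneg by (simp add: c_def)
  define t where "t = \<eta> / c"
  have t: "0 < t" "c * t = \<eta>" using \<eta> c by (auto simp: t_def)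
  \<comment> \<open>Small enough that \<open>(norm p - \<epsilon>)\<^sup>2 \<ge> (norm p)\<^sup>2 - t * \<eta>\<close>.\<close>
  define \<epsilon> where "\<epsilon> = min (norm p) (t * \<eta> / (2 * norm p))"
  have \<epsilon>: "0 < \<epsilon>" "\<epsilon> \<le> norm p" "2 * norm p * \<epsilon> \<le> t * \<eta>"
  proof -
    show "0 < \<epsilon>" "\<epsilon> \<le> norm p" using t(1) \<eta> P by (auto simp: \<epsilon>_def)
    have "\<epsilon> \<le> t * \<eta> / (2 * norm p)" by (simp add: \<epsilon>_def)
    then show "2 * norm p * \<epsilon> \<le> t * \<eta>" using P by (simp add: field_simps)
  qed
  obtain \<alpha> where \<alpha>: "\<alpha> \<in> strategies A B"
      "\<And>b s. b \<in> controls B \<Longrightarrow> s \<in> {0..t} \<Longrightarrow> infdist (trajectory f x (\<alpha> b) b s) D \<le> \<epsilon>"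
    using D x \<epsilon>(1) t(1) unfolding dominion_def by (meson less_imp_le)
  define \<beta> where "\<beta> = (\<lambda>s\<in>{0::real..}. b)"
  have \<beta>: "\<beta> \<in> controls B" unfolding \<beta>_def using b by (rule constant_control)
  have a: "\<alpha> \<beta> \<in> controls A" using \<alpha>(1) \<beta> by (auto simp: strategies_def)
  let ?X = "trajectory f x (\<alpha> \<beta>) \<beta>"
  have X0: "?X 0 = x" using trajectory_0[OF a \<beta>] .
  have disp: "norm (?X s - x) \<le> f_bound * t" if "s \<in> {0..t}" for s
    using trajectory_displacement_le[OF a \<beta>, of 0 s x] that X0 mult_left_mono[OF _ f_bound_nonneg, of s t] by auto
  have "(?X t - ?X 0) \<bullet> (- p) \<le> (- \<eta> + f_Lip * (f_bound * t) * norm (- p)) * (t - 0)"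
  proof (rule trajectory_increment_inner_le[OF a \<beta>, where q=x])
    show "f x (\<alpha> \<beta> s) (\<beta> s) \<bullet> - p \<le> - \<eta>" if "s \<in> {0..t}" for s
      using a0(2)[OF controlsD(1)[OF a, of s]] that by (simp add: \<beta>_def \<eta>_def)
  qed (use t disp in auto)
  then have inner: "- ((?X t - x) \<bullet> p) \<le> - (\<eta> * t) + f_Lip * f_bound * norm p * t\<^sup>2"
    by (simp add: X0 algebra_simps power2_eq_square)
  have "(norm (?X t - x - p))\<^sup>2 = (norm (?X t - x))\<^sup>2 - 2 * ((?X t - x) \<bullet> p) + (norm p)\<^sup>2"
    by (simp add: power2_norm_eq_inner inner_diff_left inner_diff_right inner_commute)
  also have "\<dots> \<le> (f_bound * t)\<^sup>2 + 2 * (- (\<eta> * t) + f_Lip * f_bound * norm p * t\<^sup>2) + (norm p)\<^sup>2"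
    using power_mono[OF disp[of t] norm_ge_zero, of 2] inner t(1) by simp
  also have "\<dots> = (c - 1) * t * t - 2 * \<eta> * t + (norm p)\<^sup>2"
    by (simp add: c_def algebra_simps power2_eq_square)
  also have "\<dots> < (norm p)\<^sup>2 - t * \<eta>"
  proof -
    have "(c - 1) * t * t = \<eta> * t - t * t" unfolding t(2)[symmetric] by (simp add: algebra_simps)
    moreover have "0 < t * t" using t by simp
    ultimately show ?thesis using mult.commute[of t \<eta>] by linarith
  qed
  also have "\<dots> \<le> (norm p - \<epsilon>)\<^sup>2"
    using \<epsilon>(3) zero_le_power2[of \<epsilon>] unfolding power2_diff by linarith
  finally have "norm (?X t - x - p) < norm p - \<epsilon>"
    using \<epsilon>(2) by (simp add: power_less_imp_less_base)
  moreover have "norm p \<le> infdist (?X t) D + dist (x + p) (?X t)"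
    using p infdist_triangle[of "x + p" D "?X t"] by (simp add: proximal_normals_def)
  moreover have "dist (x + p) (?X t) = norm (?X t - x - p)"
    by (simp add: dist_norm norm_minus_commute diff_diff_eq)
  moreover have "infdist (?X t) D \<le> \<epsilon>" using \<alpha>(2)[OF \<beta>, of t] t by simp
  ultimately show False by linarith
qed

end

section \<open>The proximal condition produces approximating strategies\<close>

context differential_game
begin

text \<open>
  One step of extremal aiming. Expanding the squared distance from \<open>q\<close>, the term linear in the
  displacement is at most \<open>2 h (h + f_Lip (d + f_bound h) d)\<close>, and the mixed term
  \<open>2 d h\<^sup>2\<close> is split by \<open>2 d \<le> 1 + d\<^sup>2\<close>. The constant \<open>K\<close> collects the resulting coefficients.
\<close>
lemma infdist_step:
  assumes a: "a \<in> controls A" and b: "b \<in> controls B" and u: "0 \<le> u" "t \<in> {u..u + h}"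
    and h: "0 \<le> h" "h \<le> 1" and q: "q \<in> D"
    and y: "y = trajectory f x a b u" and d: "d = norm (y - q)"
    and descent: "\<And>s. s \<in> {u..u + h} \<Longrightarrow> f q (a s) (b s) \<bullet> (y - q) \<le> h"
    and K: "K = 2 * f_Lip + f_Lip * f_bound + f_bound\<^sup>2 + 2"
  shows "(infdist (trajectory f x a b t) D)\<^sup>2 \<le> (1 + K * h) * d\<^sup>2 + K * h\<^sup>2"
proof -
  let ?X = "trajectory f x a b" and ?L = f_Lip and ?M = f_bound
  note nonneg = f_Lip_nonneg f_bound_nonneg
  have d0: "0 \<le> d" by (simp add: d)
  have disp: "norm (?X s - y) \<le> ?M * h" if "s \<in> {u..t}" for s
    using trajectory_displacement_le[OF a b, of u s x] that u mult_left_mono[OF _ nonneg(2), of "s - u" h]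
    by (auto simp: y)
  have dist_q: "norm (?X s - q) \<le> d + ?M * h" if "s \<in> {u..t}" for s
    using disp[OF that] norm_triangle_ineq[of "?X s - y" "y - q"] by (simp add: d)
  have "(?X t - ?X u) \<bullet> (y - q) \<le> (h + ?L * (d + ?M * h) * norm (y - q)) * (t - u)"
    by (rule trajectory_increment_inner_le[OF a b, where q=q]) (use u descent dist_q in auto)
  also have "\<dots> \<le> (h + ?L * (d + ?M * h) * d) * h"
    unfolding d[symmetric] using u h d0 nonneg by (intro mult_left_mono) auto
  finally have inner: "(?X t - y) \<bullet> (y - q) \<le> (h + ?L * (d + ?M * h) * d) * h" by (simp add: y)
  have "(norm (?X t - q))\<^sup>2 = (norm (?X t - y))\<^sup>2 + 2 * ((?X t - y) \<bullet> (y - q)) + d\<^sup>2"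
    by (simp add: d power2_norm_eq_inner inner_diff_left inner_diff_right inner_commute)
  also have "\<dots> \<le> (?M * h)\<^sup>2 + 2 * ((h + ?L * (d + ?M * h) * d) * h) + d\<^sup>2"
    using inner power_mono[OF disp[of t] norm_ge_zero, of 2] u by simp
  also have "\<dots> = (1 + 2 * ?L * h) * d\<^sup>2 + (?M\<^sup>2 + 2) * h\<^sup>2 + ?L * ?M * h\<^sup>2 * (2 * d)"
    by (simp add: algebra_simps power2_eq_square)
  also have "\<dots> \<le> (1 + 2 * ?L * h) * d\<^sup>2 + (?M\<^sup>2 + 2) * h\<^sup>2 + ?L * ?M * h\<^sup>2 * (1 + d\<^sup>2)"
    using nonneg h zero_le_power2[of "d - 1"]
    by (intro add_left_mono mult_left_mono) (auto simp: power2_eq_square algebra_simps)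
  also have "\<dots> \<le> (1 + 2 * ?L * h) * d\<^sup>2 + (?M\<^sup>2 + 2) * h\<^sup>2 + ?L * ?M * h\<^sup>2 + ?L * ?M * h * d\<^sup>2"
  proof -
    have "h\<^sup>2 \<le> h" using h by (simp add: power2_eq_square mult_left_le)
    then have "?L * ?M * d\<^sup>2 * h\<^sup>2 \<le> ?L * ?M * d\<^sup>2 * h" using nonneg by (intro mult_left_mono) auto
    then show ?thesis by (simp add: algebra_simps)
  qed
  also have "\<dots> \<le> (1 + K * h) * d\<^sup>2 + K * h\<^sup>2"
  proof -
    have "(1 + K * h) * d\<^sup>2 + K * h\<^sup>2 - ((1 + 2 * ?L * h) * d\<^sup>2 + (?M\<^sup>2 + 2) * h\<^sup>2 + ?L * ?M * h\<^sup>2 + ?L * ?M * h * d\<^sup>2)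
      = (?M\<^sup>2 + 2) * h * d\<^sup>2 + 2 * ?L * h\<^sup>2"
      by (simp add: K algebra_simps)
    moreover have "0 \<le> (?M\<^sup>2 + 2) * h * d\<^sup>2 + 2 * ?L * h\<^sup>2" using nonneg h by simp
    ultimately show ?thesis by linarith
  qed
  finally have "(norm (?X t - q))\<^sup>2 \<le> (1 + K * h) * d\<^sup>2 + K * h\<^sup>2" .
  moreover have "(infdist (?X t) D)\<^sup>2 \<le> (norm (?X t - q))\<^sup>2"
    using infdist_le[OF q, of "?X t"] by (intro power_mono) (auto simp: dist_norm infdist_nonneg)
  ultimately show ?thesis by linarith
qed

text \<open>
  The proximal condition at the nearest point \<open>q\<close> provides a reply to each action \<open>b\<close>; by continuity it
  remains good, up to \<open>h\<close>, for the actions near \<open>b\<close>, which permits a finite-valued Borel choice.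
\<close>
lemma descent_feedback:
  assumes D: "D \<noteq> {}" "closed D" and "0 < h"
    and prox: "\<And>x p b. x \<in> D \<Longrightarrow> p \<in> proximal_normals D x \<Longrightarrow> b \<in> B \<Longrightarrow> \<exists>a\<in>A. f x a b \<bullet> p \<le> 0"
  shows "\<exists>q \<phi>. q \<in> D \<and> norm (y - q) = infdist y D \<and> \<phi> \<in> borel \<rightarrow>\<^sub>M count_space UNIV \<and> range \<phi> \<subseteq> A \<and>
    (\<forall>b\<in>B. f q (\<phi> b) b \<bullet> (y - q) \<le> h)"
proof -
  obtain q where q: "q \<in> D" "\<And>z. z \<in> D \<Longrightarrow> dist y q \<le> dist y z"
    using distance_attains_inf[OF D(2,1)] by blast
  have "infdist y D = dist y q"
    using q D(1) infdist_le[OF q(1), of y] by (auto simp: infdist_def intro!: antisym cINF_greatest)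
  then have yq: "norm (y - q) = infdist y D" by (simp add: dist_norm)
  then have p: "y - q \<in> proximal_normals D q" by (simp add: proximal_normals_def)
  obtain \<phi> where "\<phi> \<in> borel \<rightarrow>\<^sub>M count_space UNIV" "finite (range \<phi>)" "range \<phi> \<subseteq> A"
    "\<And>b. b \<in> B \<Longrightarrow> f q (\<phi> b) b \<bullet> (y - q) \<le> h"
  proof (rule compact_finite_valued_selection[OF B_compact A_nonempty, of "\<lambda>b a. f q a b \<bullet> (y - q) \<le> h"])
    fix b assume b: "b \<in> B"
    obtain a where a: "a \<in> A" "f q a b \<bullet> (y - q) \<le> 0" using prox[OF q(1) p b] by blast
    have "continuous_on B (\<lambda>b. (\<lambda>(x, a, b). f x a b) (q, a, b))"
      by (rule continuous_on_compose2[OF f_continuous]) (use a in \<open>auto intro!: continuous_intros\<close>)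
    then have "continuous_on B (\<lambda>b. f q a b \<bullet> (y - q))" by (auto intro!: continuous_intros)
    then obtain r where r: "0 < r" "\<And>b'. b' \<in> B \<Longrightarrow> dist b' b < r \<Longrightarrow> dist (f q a b' \<bullet> (y - q)) (f q a b \<bullet> (y - q)) < h"
      using b \<open>0 < h\<close> unfolding continuous_on_iff by metis
    have "f q a b' \<bullet> (y - q) \<le> h" if "b' \<in> B \<inter> ball b r" for b'
      using r(2)[of b'] that a(2) by (auto simp: dist_real_def dist_commute)
    then show "\<exists>a\<in>A. \<exists>r>0. \<forall>b'\<in>B \<inter> ball b r. f q a b' \<bullet> (y - q) \<le> h"
      using a(1) r(1) by blast
  qed (rule that)
  then show ?thesis using q(1) yq by blast
qed

text \<open>
  The new strategy is nonanticipating: before \<open>r\<close> it coincides with \<open>\<alpha>\<close>, and if two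
  controls of player 2 agree up to a time \<open>t \<ge> r\<close>, the states at \<open>r\<close> coincide by causality,
  and so do the feedbacks selected there.
\<close>
lemma switched_strategy:
  assumes \<alpha>: "\<alpha> \<in> strategies A B" and \<phi>: "\<And>y. \<phi> y \<in> borel \<rightarrow>\<^sub>M count_space UNIV" "\<And>y. range (\<phi> y) \<subseteq> A"
    and r: "0 \<le> r"
  shows "(\<lambda>b s. if s < r then \<alpha> b s else \<phi> (trajectory f x (\<alpha> b) b r) (b s)) \<in> strategies A B"
    (is "?\<alpha>' \<in> _")
  unfolding strategies_def
proof (intro CollectI conjI Pi_I allI impI ballI)
  have \<alpha>A: "\<alpha> b \<in> controls A" if "b \<in> controls B" for b using \<alpha> that by (auto simp: strategies_def)
  show "?\<alpha>' b \<in> controls A" if b: "b \<in> controls B" for b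
    unfolding controls_def
  proof (intro IntI PiE_I)
    show "?\<alpha>' b s \<in> A" if "s \<in> {0..}" for s
      using controlsD(1)[OF \<alpha>A[OF b], of s] that \<phi>(2) by auto
    show "?\<alpha>' b s = undefined" if "s \<notin> {0..}" for s
      using controlsD(3)[OF \<alpha>A[OF b], of s] that r by auto
    have "(\<lambda>s. \<phi> (trajectory f x (\<alpha> b) b r) (b s)) \<in> lebesgue_on {0..} \<rightarrow>\<^sub>M count_space UNIV"
      by (rule measurable_compose[OF controlsD(2)[OF b] \<phi>(1)])
    then have "(\<lambda>s. \<phi> (trajectory f x (\<alpha> b) b r) (b s)) \<in> borel_measurable (lebesgue_on {0..})"
      by (rule measurable_compose) simp
    moreover have "{s \<in> space (lebesgue_on {0::real..}). s < r} \<in> sets (lebesgue_on {0..})"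
    proof -
      have "{s \<in> space (lebesgue_on {0::real..}). s < r} = {0..} \<inter> {..<r}" by auto
      then show ?thesis by (auto simp: sets_restrict_space)
    qed
    ultimately show "?\<alpha>' b \<in> borel_measurable (lebesgue_on {0..})"
      by (intro measurable_If controlsD(2)[OF \<alpha>A[OF b]])
  qed
  fix t :: real and b1 b2
  assume t: "0 < t" and b: "b1 \<in> controls B" "b2 \<in> controls B"
    and eq: "AE s in lebesgue_on {0..t}. b1 s = b2 s"
  have \<alpha>eq: "AE s in lebesgue_on {0..t}. \<alpha> b1 s = \<alpha> b2 s"
    using \<alpha> t b eq unfolding strategies_def by blast
  obtain N1 N2 where N: "negligible N1" "\<And>s. s \<in> {0..t} - N1 \<Longrightarrow> b1 s = b2 s"
    "negligible N2" "\<And>s. s \<in> {0..t} - N2 \<Longrightarrow> \<alpha> b1 s = \<alpha> b2 s"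
    using eq \<alpha>eq unfolding AE_lebesgue_on_negligible by blast
  have traj: "trajectory f x (\<alpha> b1) b1 r = trajectory f x (\<alpha> b2) b2 r" if "r \<le> t"
  proof (rule trajectory_causal[OF \<alpha>A[OF b(1)] \<alpha>A[OF b(2)] b r])
    show "AE s in lebesgue_on {0..r}. \<alpha> b1 s = \<alpha> b2 s"
      unfolding AE_lebesgue_on_negligible by (rule exI[of _ N2]) (use N that in auto)
    show "AE s in lebesgue_on {0..r}. b1 s = b2 s"
      unfolding AE_lebesgue_on_negligible by (rule exI[of _ N1]) (use N that in auto)
  qed
  have "?\<alpha>' b1 s = ?\<alpha>' b2 s" if "s \<in> {0..t} - (N1 \<union> N2)" for s
    using that N(2)[of s] N(4)[of s] traj by auto
  then show "AE s in lebesgue_on {0..t}. ?\<alpha>' b1 s = ?\<alpha>' b2 s"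
    unfolding AE_lebesgue_on_negligible by (intro exI[of _ "N1 \<union> N2"]) (use N(1,3) in auto)
qed

text \<open>
  Induction on the number of grid steps: the strategy for \<open>k\<close> steps is defined for all times, and
  switching it at time \<open>k h\<close> adds one more step without changing the trajectory before. The bound is the solution of
  the recursion \<open>e' = (1 + K h) e + K h\<^sup>2\<close> with \<open>e = 0\<close> at the start.
\<close>
lemma grid_strategy:
  assumes D: "D \<noteq> {}" "closed D" and x: "x \<in> D" and h: "0 < h" "h \<le> 1"
    and prox: "\<And>x p b. x \<in> D \<Longrightarrow> p \<in> proximal_normals D x \<Longrightarrow> b \<in> B \<Longrightarrow> \<exists>a\<in>A. f x a b \<bullet> p \<le> 0"
    and K: "K = 2 * f_Lip + f_Lip * f_bound + f_bound\<^sup>2 + 2"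
  shows "\<exists>\<alpha>\<in>strategies A B. \<forall>b\<in>controls B. \<forall>t\<in>{0..real k * h}.
    (infdist (trajectory f x (\<alpha> b) b t) D)\<^sup>2 \<le> h * ((1 + K * h) ^ k - 1)"
proof (induction k)
  case 0
  obtain a where a: "a \<in> A" using A_nonempty by blast
  define c where "c = (\<lambda>s\<in>{0::real..}. a)"
  have c: "c \<in> controls A" unfolding c_def using a by (rule constant_control)
  then have "(\<lambda>_. c) \<in> strategies A B" by (auto simp: strategies_def)
  moreover have "infdist (trajectory f x c b 0) D = 0" if "b \<in> controls B" for b
    using trajectory_0[OF c that, of x] x by simp
  ultimately show ?case by (intro bexI[of _ "\<lambda>_. c"]) auto
next
  case (Suc k)
  then obtain \<alpha> where \<alpha>: "\<alpha> \<in> strategies A B"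
    "\<And>b t. b \<in> controls B \<Longrightarrow> t \<in> {0..real k * h} \<Longrightarrow>
      (infdist (trajectory f x (\<alpha> b) b t) D)\<^sup>2 \<le> h * ((1 + K * h) ^ k - 1)" by blast
  have "\<exists>q \<phi>. q \<in> D \<and> norm (y - q) = infdist y D \<and> \<phi> \<in> borel \<rightarrow>\<^sub>M count_space UNIV \<and>
      range \<phi> \<subseteq> A \<and> (\<forall>b\<in>B. f q (\<phi> b) b \<bullet> (y - q) \<le> h)" for y
    by (rule descent_feedback[OF D h(1) prox])
  then obtain q \<phi> where q: "\<And>y. q y \<in> D" "\<And>y. norm (y - q y) = infdist y D"
    and \<phi>: "\<And>y. \<phi> y \<in> borel \<rightarrow>\<^sub>M count_space UNIV" "\<And>y. range (\<phi> y) \<subseteq> A"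
      "\<And>y b. b \<in> B \<Longrightarrow> f (q y) (\<phi> y b) b \<bullet> (y - q y) \<le> h"
    by metis
  define r where "r = real k * h"
  have r: "0 \<le> r" "real (Suc k) * h = r + h" using h by (auto simp: r_def algebra_simps)
  define \<alpha>' where "\<alpha>' = (\<lambda>b s. if s < r then \<alpha> b s else \<phi> (trajectory f x (\<alpha> b) b r) (b s))"
  have \<alpha>': "\<alpha>' \<in> strategies A B" unfolding \<alpha>'_def by (rule switched_strategy[OF \<alpha>(1) \<phi>(1,2) r(1)])
  have K0: "0 \<le> K" using f_Lip_nonneg f_bound_nonneg by (simp add: K)
  have "(infdist (trajectory f x (\<alpha>' b) b t) D)\<^sup>2 \<le> h * ((1 + K * h) ^ Suc k - 1)"
    if b: "b \<in> controls B" and t: "t \<in> {0..r + h}" for b t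
  proof -
    have \<alpha>b: "\<alpha> b \<in> controls A" "\<alpha>' b \<in> controls A" using \<alpha>(1) \<alpha>' b by (auto simp: strategies_def)
    have same: "trajectory f x (\<alpha>' b) b s = trajectory f x (\<alpha> b) b s" if "s \<in> {0..r}" for s
    proof (rule trajectory_causal[OF \<alpha>b(2,1) b b])
      show "AE u in lebesgue_on {0..s}. \<alpha>' b u = \<alpha> b u"
        unfolding AE_lebesgue_on_negligible
        by (rule exI[of _ "{r}"]) (use that in \<open>auto simp: \<alpha>'_def\<close>)
    qed (use that in auto)
    show ?thesis
    proof (cases "t \<le> r")
      case True
      have "(1 + K * h) ^ k \<le> (1 + K * h) ^ Suc k" using K0 h by (intro power_increasing) auto
      then have "h * ((1 + K * h) ^ k - 1) \<le> h * ((1 + K * h) ^ Suc k - 1)" using h by (intro mult_left_mono) auto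
      moreover have "(infdist (trajectory f x (\<alpha>' b) b t) D)\<^sup>2 \<le> h * ((1 + K * h) ^ k - 1)"
        using \<alpha>(2)[OF b, of t] same[of t] True t by (simp add: r_def)
      ultimately show ?thesis by linarith
    next
      case False
      define y where "y = trajectory f x (\<alpha>' b) b r"
      have y: "y = trajectory f x (\<alpha> b) b r" unfolding y_def using same[of r] r by simp
      have "(infdist (trajectory f x (\<alpha>' b) b t) D)\<^sup>2 \<le> (1 + K * h) * (infdist y D)\<^sup>2 + K * h\<^sup>2"
      proof (rule infdist_step[OF \<alpha>b(2) b r(1) _ _ h(2) q(1)[of y] y_def q(2)[symmetric] _ K])
        fix s assume "s \<in> {r..r + h}"
        then show "f (q y) (\<alpha>' b s) (b s) \<bullet> (y - q y) \<le> h"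
          using \<phi>(3)[OF controlsD(1)[OF b, of s], of y] r by (simp add: \<alpha>'_def y)
      qed (use h t False in auto)
      also have "\<dots> \<le> (1 + K * h) * (h * ((1 + K * h) ^ k - 1)) + K * h\<^sup>2"
        using \<alpha>(2)[OF b, of r] K0 h r by (intro add_right_mono mult_left_mono) (auto simp: y r_def)
      also have "\<dots> = h * ((1 + K * h) ^ Suc k - 1)" by (simp add: algebra_simps power2_eq_square)
      finally show ?thesis .
    qed
  qed
  then show ?case using \<alpha>' r(2) by (intro bexI[of _ \<alpha>']) auto
qed

lemma proximal_condition_imp_dominion:
  assumes D: "D \<noteq> {}" "closed D"
    and prox: "\<And>x p b. x \<in> D \<Longrightarrow> p \<in> proximal_normals D x \<Longrightarrow> b \<in> B \<Longrightarrow> \<exists>a\<in>A. f x a b \<bullet> p \<le> 0"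
  shows "dominion A B f D"
  unfolding dominion_def
proof (intro conjI D ballI allI impI)
  fix \<epsilon> T :: real and z assume x: "z \<in> D" and \<epsilon>: "0 < \<epsilon>" and T: "0 \<le> T"
  define K where "K = 2 * f_Lip + f_Lip * f_bound + f_bound\<^sup>2 + 2"
  have K0: "0 \<le> K" using f_Lip_nonneg f_bound_nonneg by (simp add: K_def)
  \<comment> \<open>The grid covers \<open>[0, T + 1]\<close> rather than \<open>[0, T]\<close>, so that its step is positive even when \<open>T = 0\<close>.\<close>
  define E where "E = exp (K * (T + 1))"
  obtain n where n: "(T + 1) * (1 + E / \<epsilon>\<^sup>2) < real n" using reals_Archimedean2 by blast
  define h where "h = (T + 1) / real n"
  have "0 \<le> (T + 1) * (E / \<epsilon>\<^sup>2)" using T by (simp add: E_def)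
  then have n': "T + 1 < real n" "(T + 1) * E / \<epsilon>\<^sup>2 < real n"
    using n T by (auto simp: algebra_simps)
  then have n0: "0 < real n" using T by linarith
  have h: "0 < h" "h \<le> 1" "real n * h = T + 1" using n' n0 T by (auto simp: h_def)
  have "(1 + K * h) ^ n \<le> exp (K * h) ^ n"
    using K0 h by (intro power_mono exp_ge_add_one_self) auto
  also have "\<dots> = exp (real n * (K * h))" by (simp add: exp_of_nat_mult)
  also have "real n * (K * h) = K * (T + 1)" using h(3) by (simp add: algebra_simps)
  finally have "(1 + K * h) ^ n - 1 \<le> E" by (simp add: E_def)
  then have "h * ((1 + K * h) ^ n - 1) \<le> h * E" using h by (intro mult_left_mono) auto
  also have "\<dots> \<le> \<epsilon>\<^sup>2" using n'(2) n0 \<epsilon> by (simp add: h_def field_simps)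
  finally have small: "h * ((1 + K * h) ^ n - 1) \<le> \<epsilon>\<^sup>2" .
  obtain \<alpha> where \<alpha>: "\<alpha> \<in> strategies A B" "\<And>b t. b \<in> controls B \<Longrightarrow> t \<in> {0..real n * h} \<Longrightarrow>
      (infdist (trajectory f z (\<alpha> b) b t) D)\<^sup>2 \<le> h * ((1 + K * h) ^ n - 1)"
    using grid_strategy[OF D x h(1,2) prox K_def, of n] by blast
  have "infdist (trajectory f z (\<alpha> b) b t) D \<le> \<epsilon>" if "b \<in> controls B" "t \<in> {0..T}" for b t
  proof -
    have "(infdist (trajectory f z (\<alpha> b) b t) D)\<^sup>2 \<le> \<epsilon>\<^sup>2"
      using \<alpha>(2)[OF that(1), of t] that(2) h(3) small by auto
    then show ?thesis by (rule power2_le_imp_le) (use \<epsilon> in simp)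
  qed
  then show "\<exists>\<alpha>\<in>strategies A B. \<forall>b\<in>controls B. \<forall>t\<in>{0..T}. infdist (trajectory f z (\<alpha> b) b t) D \<le> \<epsilon>"
    using \<alpha>(1) by (intro bexI[of _ \<alpha>]) auto
qed

end

section \<open>Characterization of dominions\<close>

theorem theorem6p2:
  fixes A :: "'a::metric_space set"
    and B :: "'b::metric_space set"
    and f :: "real ^ 'n \<Rightarrow> 'a \<Rightarrow> 'b \<Rightarrow> real ^ 'n"
    and l :: "real ^ 'n \<Rightarrow> 'a \<Rightarrow> 'b \<Rightarrow> real"
    and D :: "(real ^ 'n) set"
  assumes "differential_game A B f l"
    and "D \<noteq> {}" and "closed D"
  shows "(dominion A B f D \<longleftrightarrow> (\<forall>x\<in>D. \<forall>p\<in>proximal_normals D x. H_inf A B f x p \<ge> 0)) \<and>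
    (dominion A B f D \<longleftrightarrow>
      (\<forall>x\<in>D. \<forall>p\<in>proximal_normals D x. (SUP b\<in>B. INF a\<in>A. f x a b \<bullet> p) \<le> 0))"
proof -
  interpret differential_game A B f l by fact
  have "dominion A B f D \<longleftrightarrow> (\<forall>x\<in>D. \<forall>p\<in>proximal_normals D x. \<forall>b\<in>B. \<exists>a\<in>A. f x a b \<bullet> p \<le> 0)"
    (is "_ \<longleftrightarrow> ?C")
  proof
    show ?C if "dominion A B f D" using dominion_imp_proximal_condition[OF that] by simp
    show "dominion A B f D" if ?C using proximal_condition_imp_dominion[OF assms(2,3)] that by simp
  qed
  then show ?thesis unfolding H_inf_nonneg_iff max_min_nonpos_iff by blast
qed

end
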